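(* Let $C\subseteq\mathbb R$ be homeomorphic to the Cantor space and algebraically independent over $\mathbb Q$, and identify $\overline{\mathbb N}^{\uparrow\mathbb N}$ with $C$ via a fixed homeomorphism. Let $\mathcal F$ be the Fréchet filter (so that $\mathfrak b(\mathcal F)=\mathfrak b$), let $S=\{f_\alpha:\alpha<\mathfrak b\}$ be any $\mathfrak b(\mathcal F)$-scale, and let $X=S\cup Q\subseteq\overline{\mathbb N}^{\uparrow\mathbb N}=C\subseteq\mathbb R$. Then all finite powers of $\mathbb Q(X)$, the subfield of $\mathbb R$ generated by $\mathbb Q\cup X$, have the Hurewicz property and are universally null and universally meager.
   Context: $\mathbb N=\{0,1,2,\dots\}$, discrete; $\mathbb N^{\mathbb N}$ has the product topology. The Fréchet filter is the family of all cofinite subsets of $\mathbb N$. For $f,g\in\mathbb N^{\mathbb N}$, $f\le^*g$ means $f(n)\le g(n)$ for all but finitely many $n$; for $\mathcal F$ the Fréchet filter, $\le_{\mathcal F}$ is $\le^*$. A set $Y\subseteq\mathbb N^{\mathbb N}$ is bounded (with respect to $\le^*$) if there is $g\in\mathbb N^{\mathbb N}$ with $f\le^*g$ for all $f\in Y$; otherwise it is unbounded. $\mathfrak b$ is the minimal cardinality of an unbounded subset of $\mathbb N^{\mathbb N}$. $\mathbb N^{\uparrow\mathbb N}$ is the set of (strictly) increasing elements of $\mathbb N^{\mathbb N}$. For $\mathcal F$ the Fréchet filter, a $\mathfrak b(\mathcal F)$-scale is an unbounded family $S=\{f_\alpha:\alpha<\mathfrak b\}\subseteq\mathbb N^{\uparrow\mathbb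 N}$ with $f_\alpha\le^*f_\beta$ for all $\alpha<\beta<\mathfrak b$. A space has the Hurewicz property if each of its continuous images in $\mathbb N^{\mathbb N}$ is bounded with respect to $\le^*$. $\overline{\mathbb N}=\mathbb N\cup\{\infty\}$ is the one-point compactification of $\mathbb N$. $\overline{\mathbb N}^{\uparrow\mathbb N}$ is the subspace of the product $\overline{\mathbb N}^{\mathbb N}$ consisting of the nondecreasing $f$ such that $f(n)<f(n+1)$ whenever $f(n)<\infty$; it is homeomorphic to the Cantor space. $Q$ (not to be confused with the rationals $\mathbb Q$) is the countable set of all $f\in\overline{\mathbb N}^{\uparrow\mathbb N}$ that take the value $\infty$; thus $\overline{\mathbb N}^{\uparrow\mathbb N}=Q\cup\mathbb N^{\uparrow\mathbb N}$. A set $C$ as in the claim exists by a classical theorem of von Neumann. A separable metrizable space $Y$ is universally null if every Borel isomorphic image of $Y$ in $\mathbb R$ has Lebesgue measure zero; equivalently, every finite $\sigma$-additive measure $\mu$ on the Borel subsets of $Y$ with $\mu\{y\}=0$ for all $y\in Y$ satisfies $\mu(Y)=0$. $Y$ is universally meager if every Borel isomorphic image of $Y$ in $\mathbb R$ is meager in $\mathbb R$. *)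

theory Defs
  imports
    "HOL-Analysis.Analysis"
    "HOL-Library.Poly_Mapping"
    "HOL-Algebra.Generated_Fields"
    "HOL-Algebra.Algebraic_Closure_Type"
begin

no_notation var (\<open>X\<index>\<close>)

section \<open>Eventual domination, the bounding number and scales\<close>

text \<open>The filter \<^const>\<open>cofinite\<close> on \<^typ>\<open>nat\<close> is the Frechet filter.\<close>

definition le_star :: "(nat \<Rightarrow> nat) \<Rightarrow> (nat \<Rightarrow> nat) \<Rightarrow> bool" (infix \<open>\<le>*\<close> 50)
  where "f \<le>* g \<longleftrightarrow> (\<forall>\<^sub>F n in cofinite. f n \<le> g n)"

definition bounded_star :: "(nat \<Rightarrow> nat) set \<Rightarrow> bool"
  where "bounded_star Y \<longleftrightarrow> (\<exists>g. \<forall>f\<in>Y. f \<le>* g)"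

text \<open>
  The cardinal \<open>\<bb>\<close> is represented, as usual for cardinals in HOL, by a well-order of minimal
  order type on its field. The choice of the particular well-order is immaterial: any two
  candidates are isomorphic. That a candidate exists is \<open>bounding_number_is\<close> below.
\<close>

definition is_bounding_number :: "(nat \<Rightarrow> nat) rel \<Rightarrow> bool"
  where "is_bounding_number r \<longleftrightarrow>
    (\<exists>Y. \<not> bounded_star Y \<and> r = card_of Y) \<and>
    (\<forall>Z. \<not> bounded_star Z \<longrightarrow> (r, card_of Z) \<in> ordLeq)"

definition bounding_number :: "(nat \<Rightarrow> nat) rel"
  where "bounding_number = (SOME r. is_bounding_number r)"

lemma not_bounded_star_UNIV: "\<not> bounded_star UNIV"
proof
  assume "bounded_star UNIV"
  then obtain g where "(\<lambda>n. Suc (g n)) \<le>* g"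
    unfolding bounded_star_def by blast
  then show False
    by (simp add: le_star_def eventually_cofinite)
qed

lemma bounding_number_is: "is_bounding_number bounding_number"
proof -
  let ?R = "card_of ` {Y. \<not> bounded_star Y}"
  have "?R \<noteq> {}" "\<forall>r\<in>?R. Card_order r"
    using not_bounded_star_UNIV card_of_Card_order by auto
  then obtain r where "r \<in> ?R" "\<forall>r'\<in>?R. (r, r') \<in> ordLeq"
    using exists_minim_Card_order[of ?R] by blast
  then have "is_bounding_number r"
    unfolding is_bounding_number_def by blast
  then show ?thesis
    unfolding bounding_number_def by (rule someI)
qed

text \<open>
  The indices \<open>\<alpha> < \<bb>\<close> are the elements of the field of \<^const>\<open>bounding_number\<close>, and
  \<open>\<alpha> < \<beta>\<close> is the strict part of this (reflexive) well-order.
\<close>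

definition b_scale :: "(nat \<Rightarrow> nat) set \<Rightarrow> bool"
  where "b_scale S \<longleftrightarrow>
    \<not> bounded_star S \<and> (\<forall>f\<in>S. strict_mono f) \<and>
    (\<exists>F. S = F ` Field bounding_number \<and>
      (\<forall>\<alpha> \<beta>. (\<alpha>, \<beta>) \<in> bounding_number \<and> \<alpha> \<noteq> \<beta> \<longrightarrow> F \<alpha> \<le>* F \<beta>))"

section \<open>Increasing sequences in the one-point compactification of the naturals\<close>

text \<open>
  The order topology of \<^typ>\<open>enat\<close> is the topology of the one-point compactification of the
  discrete space \<^typ>\<open>nat\<close>; function types carry the product topology.
\<close>

definition increasing_enat :: "(nat \<Rightarrow> enat) set"
  where "increasing_enat = {f. mono f \<and> (\<forall>n. f n < \<infinity> \<longrightarrow> f n < f (Suc n))}"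

definition increasing_enat_inf :: "(nat \<Rightarrow> enat) set"
  where "increasing_enat_inf = {f \<in> increasing_enat. \<exists>n. f n = \<infinity>}"

section \<open>Algebraic independence and generated subfields of the reals\<close>

text \<open>
  An element of \<^typ>\<open>(real \<Rightarrow>\<^sub>0 nat) \<Rightarrow>\<^sub>0 rat\<close> is a polynomial with rational coefficients in
  one indeterminate for every real number; \<open>eval_at_indices\<close> substitutes for each
  indeterminate the real number that indexes it.
\<close>

definition eval_at_indices :: "((real \<Rightarrow>\<^sub>0 nat) \<Rightarrow>\<^sub>0 rat) \<Rightarrow> real"
  where "eval_at_indices p =
    (\<Sum>m\<in>Poly_Mapping.keys p. of_rat (Poly_Mapping.lookup p m) *
      (\<Prod>x\<in>Poly_Mapping.keys m. x ^ Poly_Mapping.lookup m x))"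

definition algebraically_independent_over_Rats :: "real set \<Rightarrow> bool"
  where "algebraically_independent_over_Rats C \<longleftrightarrow>
    (\<forall>p. (\<forall>m\<in>Poly_Mapping.keys p. Poly_Mapping.keys m \<subseteq> C) \<and> eval_at_indices p = 0
      \<longrightarrow> p = 0)"

definition rat_field_generated :: "real set \<Rightarrow> real set"
  where "rat_field_generated X = generate_field ring_of_type_algebra (\<rat> \<union> X)"

section \<open>Topological and Borel smallness properties\<close>

definition finite_power :: "'a::topological_space set \<Rightarrow> nat \<Rightarrow> (nat \<Rightarrow> 'a) topology"
  where "finite_power Y n = product_topology (\<lambda>_. top_of_set Y) {..<n}"

definition hurewicz_space :: "'a topology \<Rightarrow> bool"
  where "hurewicz_space T \<longleftrightarrow>
    (\<forall>\<phi> :: 'a \<Rightarrow> nat \<Rightarrow> nat. continuous_map T euclidean \<phi> \<longrightarrow> bounded_star (\<phi> ` topspace T))"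

definition borel_measure_of :: "'a topology \<Rightarrow> 'a measure"
  where "borel_measure_of T = sigma (topspace T) {U. openin T U}"

definition borel_isomorphic_image :: "'a topology \<Rightarrow> real set \<Rightarrow> bool"
  where "borel_isomorphic_image T Z \<longleftrightarrow>
    (\<exists>\<phi>. bij_betw \<phi> (topspace T) Z \<and>
      \<phi> \<in> measurable (borel_measure_of T) (borel_measure_of (top_of_set Z)) \<and>
      inv_into (topspace T) \<phi> \<in> measurable (borel_measure_of (top_of_set Z)) (borel_measure_of T))"

definition meager :: "'a::topological_space set \<Rightarrow> bool"
  where "meager S \<longleftrightarrow>
    (\<exists>\<N>. countable \<N> \<and> (\<forall>N\<in>\<N>. interior (closure N) = {}) \<and> S \<subseteq> \<Union>\<N>)"

definition universally_null :: "'a topology \<Rightarrow> bool"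
  where "universally_null T \<longleftrightarrow>
    metrizable_space T \<and> separable_space T \<and>
    (\<forall>Z. borel_isomorphic_image T Z \<longrightarrow> Z \<in> null_sets lebesgue)"

definition universally_meager :: "'a topology \<Rightarrow> bool"
  where "universally_meager T \<longleftrightarrow>
    metrizable_space T \<and> separable_space T \<and>
    (\<forall>Z. borel_isomorphic_image T Z \<longrightarrow> meager Z)"

end

theory Submission
  imports Defs
begin

text \<open>
  Hurewicz: the product of \<open>S \<union> Q\<close> with any space \<open>Z\<close> having the covering form of the property
  has it again. Points of \<open>Q\<close> have neighbourhoods that depend only on a long gap in the range of a
  sequence, and the Hurewicz property of \<open>Z\<close> makes the required gap lengths uniform in \<open>Z\<close>. Some
  member of the scale is infinitely often above the function that forces such gaps, hence so are
  all later ones; the earlier ones are fewer than \<open>\<bb>\<close> many. As \<open>\<rat>(X)\<close> is a countable union of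
  continuous images of closed subsets of powers of \<open>X\<close>, the property passes to its powers.

  Smallness: null and meager sets both form a \<open>\<sigma>\<close>-ideal satisfying a Fubini theorem, and under any
  Borel map into \<open>S\<close> with small fibres the Borel relation \<open>\<le>*\<close>, which well-orders \<open>S\<close> up to finite
  modifications, would violate it unless the domain is small. By algebraic independence every element of \<open>\<rat>(X)\<close> has a least finite support
  in \<open>X\<close>, which depends on it in a Borel way and determines it up to countably many choices.
\<close>

section \<open>The covering form of the Hurewicz property\<close>

text \<open>The two halves treat the field differently because the properties behave differently.
  The Hurewicz property of two spaces does not by itself give that of their product, so the
  inductions carry the stronger statement that multiplying by an arbitrary Hurewicz space preserves
  the property. Coordinates can then be added one at a time, first in powers of the scale set and
  then in powers of the field. Smallness in the Borel sense is not inherited by continuous images,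
  so writing the field as a union of such images does not help. The passage from points of
  \<open>X\<close> to elements of the field has to be inverted, in a Borel way and up to countable
  ambiguity; this is what algebraic independence is for. A Borel isomorphic image \<open>Z\<close>
  may be neither measurable nor have the Baire property. Fubini arguments therefore run through a
  substitute for \<open>Z\<close>: a measurable envelope for measure, an open set in which
  \<open>Z\<close> is everywhere nonmeager for category.\<close>

text \<open>\<open>V n\<close> stands for the increasing finite unions of the n-th countable open
  cover, so that choosing a finite subfamily amounts to choosing one index \<open>g n\<close>.
  Unlike \<open>hurewicz_space\<close>, this form says something even about spaces with few
  continuous maps into the sequence space.\<close>

definition hurewicz_covering :: "'a topology \<Rightarrow> bool"
  where "hurewicz_covering T \<longleftrightarrow>
    (\<forall>V :: nat \<Rightarrow> nat \<Rightarrow> 'a set.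
      (\<forall>n m. openin T (V n m)) \<and> (\<forall>n. mono (V n)) \<and> (\<forall>n. topspace T \<subseteq> (\<Union>m. V n m)) \<longrightarrow>
      (\<exists>g. \<forall>x\<in>topspace T. \<forall>\<^sub>F n in sequentially. x \<in> V n (g n)))"

lemma hurewicz_coveringI:
  assumes "\<And>V :: nat \<Rightarrow> nat \<Rightarrow> 'a set. (\<And>n m. openin T (V n m)) \<Longrightarrow> (\<And>n i j. i \<le> j \<Longrightarrow> V n i \<subseteq> V n j)
     \<Longrightarrow> (\<And>n x. x \<in> topspace T \<Longrightarrow> \<exists>m. x \<in> V n m)
     \<Longrightarrow> \<exists>g. \<forall>x\<in>topspace T. \<forall>\<^sub>F n in sequentially. x \<in> V n (g n)"
  shows "hurewicz_covering T"
  unfolding hurewicz_covering_def mono_def using assms by (metis UN_iff subsetD)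

lemma hurewicz_coveringD:
  fixes V :: "nat \<Rightarrow> nat \<Rightarrow> 'a set"
  assumes "hurewicz_covering T" "\<And>n m. openin T (V n m)" "\<And>n i j. i \<le> j \<Longrightarrow> V n i \<subseteq> V n j"
     "\<And>n x. x \<in> topspace T \<Longrightarrow> \<exists>m. x \<in> V n m"
  obtains g where "\<And>x. x \<in> topspace T \<Longrightarrow> \<forall>\<^sub>F n in sequentially. x \<in> V n (g n)"
proof -
  have "\<forall>n. mono (V n)" "\<forall>n. topspace T \<subseteq> (\<Union>m. V n m)"
    using assms(3,4) by (auto simp: mono_def)
  then show ?thesis using assms(1,2) that unfolding hurewicz_covering_def by blast
qed

lemma hurewicz_covering_imp_hurewicz_space:
  assumes "hurewicz_covering T"
  shows "hurewicz_space T"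
  unfolding hurewicz_space_def
proof (intro allI impI)
  fix \<phi> :: "'a \<Rightarrow> nat \<Rightarrow> nat" assume c: "continuous_map T euclidean \<phi>"
  have o: "openin T {x \<in> topspace T. \<phi> x n \<le> m}" for n m
  proof -
    have "open {f :: nat \<Rightarrow> nat. f n \<in> {..m}}"
      using open_vimage[of "{..m}" "\<lambda>f :: nat \<Rightarrow> nat. f n"]
      by (simp add: vimage_def open_discrete continuous_on_component)
    then have "openin T {x \<in> topspace T. \<phi> x \<in> {f. f n \<in> {..m}}}"
      using c openin_continuous_map_preimage by fastforce
    then show ?thesis by simp
  qed
  obtain g where g: "\<And>x. x \<in> topspace T \<Longrightarrow> \<forall>\<^sub>F n in sequentially. x \<in> {x \<in> topspace T. \<phi> x n \<le> g n}"
    by (rule hurewicz_coveringD[OF assms, where V = "\<lambda>n m. {x \<in> topspace T. \<phi> x n \<le> m}"])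
       (use o in \<open>auto\<close>)
  show "bounded_star (\<phi> ` topspace T)"
    unfolding bounded_star_def le_star_def cofinite_eq_sequentially
  proof (intro exI[of _ g] ballI)
    fix f assume "f \<in> \<phi> ` topspace T"
    then obtain x where x: "x \<in> topspace T" "f = \<phi> x" by blast
    show "\<forall>\<^sub>F n in sequentially. f n \<le> g n"
      using g[OF x(1)] by eventually_elim (use x in auto)
  qed
qed

lemma hurewicz_covering_continuous_image:
  assumes T: "hurewicz_covering T" and f: "continuous_map T T' f" and onto: "topspace T' \<subseteq> f ` topspace T"
  shows "hurewicz_covering T'"
proof (rule hurewicz_coveringI)
  fix V :: "nat \<Rightarrow> nat \<Rightarrow> 'b set"
  assume V: "\<And>n m. openin T' (V n m)" "\<And>n i j. i \<le> j \<Longrightarrow> V n i \<subseteq> V n j"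
     "\<And>n x. x \<in> topspace T' \<Longrightarrow> \<exists>m. x \<in> V n m"
  have ft: "x \<in> topspace T \<Longrightarrow> f x \<in> topspace T'" for x
    using continuous_map_image_subset_topspace[OF f] by blast
  obtain g where g: "\<And>x. x \<in> topspace T \<Longrightarrow> \<forall>\<^sub>F n in sequentially. x \<in> {x \<in> topspace T. f x \<in> V n (g n)}"
  proof (rule hurewicz_coveringD[OF T, where V = "\<lambda>n m. {x \<in> topspace T. f x \<in> V n m}"])
    show "openin T {x \<in> topspace T. f x \<in> V n m}" for n m
      using openin_continuous_map_preimage[OF f V(1)] by simp
  qed (use V ft in \<open>blast+\<close>)
  show "\<exists>g. \<forall>x\<in>topspace T'. \<forall>\<^sub>F n in sequentially. x \<in> V n (g n)"
  proof (intro exI ballI)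
    fix y assume "y \<in> topspace T'"
    then obtain x where x: "x \<in> topspace T" "y = f x" using onto by blast
    show "\<forall>\<^sub>F n in sequentially. y \<in> V n (g n)"
      using g[OF x(1)] by eventually_elim (use x in auto)
  qed
qed

lemma hurewicz_covering_closed_subset:
  assumes T: "hurewicz_covering T" and E: "closedin T E"
  shows "hurewicz_covering (subtopology T E)"
proof (rule hurewicz_coveringI)
  fix V :: "nat \<Rightarrow> nat \<Rightarrow> 'a set"
  assume V: "\<And>n m. openin (subtopology T E) (V n m)" "\<And>n i j. i \<le> j \<Longrightarrow> V n i \<subseteq> V n j"
     "\<And>n x. x \<in> topspace (subtopology T E) \<Longrightarrow> \<exists>m. x \<in> V n m"
  have E': "E \<subseteq> topspace T" using E closedin_subset by blast
  \<comment> \<open>Adding the open complement of \<open>E\<close> to every set turns covers of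
    \<open>E\<close> into covers of the whole space and changes nothing on \<open>E\<close>.\<close>
  have o: "openin T (V n m \<union> (topspace T - E))" for n m
  proof -
    obtain U where U: "openin T U" "V n m = U \<inter> E"
      using V(1) openin_subtopology by metis
    have "V n m \<union> (topspace T - E) = U \<union> (topspace T - E)"
      using U openin_subset by fastforce
    then show ?thesis using U E by (simp add: openin_Un closedin_def)
  qed
  obtain g where g: "\<And>x. x \<in> topspace T \<Longrightarrow> \<forall>\<^sub>F n in sequentially. x \<in> V n (g n) \<union> (topspace T - E)"
  proof (rule hurewicz_coveringD[OF T, where V = "\<lambda>n m. V n m \<union> (topspace T - E)"])
    show "V n i \<union> (topspace T - E) \<subseteq> V n j \<union> (topspace T - E)" if "i \<le> j" for n i j
      using V(2)[OF that] by blast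
    show "\<exists>m. x \<in> V n m \<union> (topspace T - E)" if "x \<in> topspace T" for n x
      using V(3)[of x n] that by (cases "x \<in> E") auto
  qed (use o in blast)+
  show "\<exists>g. \<forall>x\<in>topspace (subtopology T E). \<forall>\<^sub>F n in sequentially. x \<in> V n (g n)"
  proof (intro exI ballI)
    fix x assume x: "x \<in> topspace (subtopology T E)"
    then have "\<forall>\<^sub>F n in sequentially. x \<in> V n (g n) \<union> (topspace T - E)" by (intro g) simp
    then show "\<forall>\<^sub>F n in sequentially. x \<in> V n (g n)" by eventually_elim (use x in auto)
  qed
qed

text \<open>Diagonal bound: the value at \<open>n\<close> is the maximum of the first
  \<open>n + 1\<close> functions there, so the i-th function is dominated from \<open>n = i\<close>
  on.\<close>

lemma countable_bounded_star:
  fixes G :: "nat \<Rightarrow> nat \<Rightarrow> nat"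
  shows "\<exists>g. \<forall>i. \<forall>\<^sub>F n in sequentially. G i n \<le> g n"
proof (intro exI allI)
  fix i
  show "\<forall>\<^sub>F n in sequentially. G i n \<le> Max ((\<lambda>j. G j n) ` {..n})"
    using eventually_ge_at_top[of i]
    by eventually_elim (auto intro: Max_ge)
qed

text \<open>The pieces may be arbitrary subsets: the covers restrict to each piece, and the
  countably many index functions obtained there have a common eventual bound.\<close>

lemma hurewicz_covering_countable_Union:
  assumes "countable \<A>" and A: "\<And>A. A \<in> \<A> \<Longrightarrow> hurewicz_covering (subtopology T A)"
    and cover: "topspace T \<subseteq> \<Union>\<A>"
  shows "hurewicz_covering T"
proof (rule hurewicz_coveringI)
  fix V :: "nat \<Rightarrow> nat \<Rightarrow> 'a set"
  assume V: "\<And>n m. openin T (V n m)" "\<And>n i j. i \<le> j \<Longrightarrow> V n i \<subseteq> V n j"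
     "\<And>n x. x \<in> topspace T \<Longrightarrow> \<exists>m. x \<in> V n m"
  have "\<exists>g. \<forall>x\<in>topspace T \<inter> A. \<forall>\<^sub>F n in sequentially. x \<in> V n (g n)" if hA: "A \<in> \<A>" for A
  proof -
    obtain g where g: "\<And>x. x \<in> topspace (subtopology T A) \<Longrightarrow> \<forall>\<^sub>F n in sequentially. x \<in> V n (g n) \<inter> A"
    proof (rule hurewicz_coveringD[OF A[OF hA], where V = "\<lambda>n m. V n m \<inter> A"])
      show "openin (subtopology T A) (V n m \<inter> A)" for n m
        using V(1) openin_subtopology by blast
      show "V n i \<inter> A \<subseteq> V n j \<inter> A" if "i \<le> j" for n i j
        using V(2)[OF that] by blast
    qed (use V(3) in auto)
    have "\<forall>\<^sub>F n in sequentially. x \<in> V n (g n)" if "x \<in> topspace T \<inter> A" for x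
      using g[of x] that by (auto elim: eventually_mono)
    then show ?thesis by blast
  qed
  then obtain G where G: "\<And>A x. A \<in> \<A> \<Longrightarrow> x \<in> topspace T \<inter> A \<Longrightarrow> \<forall>\<^sub>F n in sequentially. x \<in> V n (G A n)"
    by metis
  obtain g where g: "\<And>i. \<forall>\<^sub>F n in sequentially. G (from_nat_into \<A> i) n \<le> g n"
    using countable_bounded_star[of "\<lambda>i. G (from_nat_into \<A> i)"] by blast
  show "\<exists>g. \<forall>x\<in>topspace T. \<forall>\<^sub>F n in sequentially. x \<in> V n (g n)"
  proof (intro exI ballI)
    fix x assume x: "x \<in> topspace T"
    then obtain A where A: "A \<in> \<A>" "x \<in> A" using cover by blast
    have "from_nat_into \<A> (to_nat_on \<A> A) = A"
      using A(1) assms(1) by simp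
    with g[of "to_nat_on \<A> A"] have "\<forall>\<^sub>F n in sequentially. G A n \<le> g n" by simp
    moreover have "\<forall>\<^sub>F n in sequentially. x \<in> V n (G A n)"
      using G[OF A(1), of x] A(2) x by blast
    ultimately show "\<forall>\<^sub>F n in sequentially. x \<in> V n (g n)"
      by eventually_elim (use V(2) in blast)
  qed
qed

text \<open>One coordinate is split off at a time. The auxiliary space \<open>W\<close> of
  \<open>step\<close> is the product of the remaining power with \<open>Z\<close>, hence its type of
  points.\<close>

lemma hurewicz_covering_prod_power:
  fixes Z :: "'b topology" and Y :: "'a::topological_space set"
  assumes step: "\<And>W :: ((nat \<Rightarrow> 'a) \<times> 'b) topology.
      hurewicz_covering W \<Longrightarrow> hurewicz_covering (prod_topology (top_of_set Y) W)"
    and Z: "hurewicz_covering Z"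
  shows "hurewicz_covering (prod_topology (finite_power Y N) Z)"
proof (induction N)
  case 0
  show ?case
  proof (rule hurewicz_covering_continuous_image[OF Z])
    have "topspace (finite_power Y 0) = {\<lambda>_. undefined}"
      by (simp add: finite_power_def)
    then show "continuous_map Z (prod_topology (finite_power Y 0) Z) (\<lambda>z. (\<lambda>_. undefined, z))"
      "topspace (prod_topology (finite_power Y 0) Z) \<subseteq> (\<lambda>z. (\<lambda>_. undefined, z)) ` topspace Z"
      by (auto intro!: continuous_map_pairedI)
  qed
next
  case (Suc N)
  let ?f = "\<lambda>(y, x, z). (x(N := y), z)"
  show ?case
  proof (rule hurewicz_covering_continuous_image[OF step[OF Suc.IH]])
    have "continuous_map (prod_topology (top_of_set Y) (prod_topology (finite_power Y N) Z))
        (product_topology (\<lambda>_. top_of_set Y) {..<Suc N}) (\<lambda>p. (fst (snd p))(N := fst p))"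
      unfolding continuous_map_componentwise
    proof (intro conjI ballI)
      show "(\<lambda>p. (fst (snd p))(N := fst p)) `
        topspace (prod_topology (top_of_set Y) (prod_topology (finite_power Y N) Z)) \<subseteq> extensional {..<Suc N}"
        by (auto simp: finite_power_def PiE_def extensional_def)
      fix k assume k: "k \<in> {..<Suc N}"
      show "continuous_map (prod_topology (top_of_set Y) (prod_topology (finite_power Y N) Z)) (top_of_set Y)
          (\<lambda>p. ((fst (snd p))(N := fst p)) k)"
      proof (cases "k = N")
        case True
        then show ?thesis by (simp add: continuous_map_fst)
      next
        case False
        then have kN: "k \<in> {..<N}" using k by auto
        have "continuous_map (prod_topology (top_of_set Y) (prod_topology (finite_power Y N) Z)) (finite_power Y N)
            (fst \<circ> snd)"
          by (rule continuous_map_compose[OF continuous_map_snd continuous_map_fst])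
        from continuous_map_compose[OF this[unfolded finite_power_def] continuous_map_product_projection[OF kN]] False
        show ?thesis by (simp add: o_def finite_power_def)
      qed
    qed
    moreover have "continuous_map (prod_topology (top_of_set Y) (prod_topology (finite_power Y N) Z)) Z
            (snd \<circ> snd)"
      by (rule continuous_map_compose[OF continuous_map_snd continuous_map_snd])
    ultimately show "continuous_map (prod_topology (top_of_set Y) (prod_topology (finite_power Y N) Z))
        (prod_topology (finite_power Y (Suc N)) Z) ?f"
      by (simp add: case_prod_unfold continuous_map_pairedI finite_power_def o_def)
    show "topspace (prod_topology (finite_power Y (Suc N)) Z)
        \<subseteq> ?f ` topspace (prod_topology (top_of_set Y) (prod_topology (finite_power Y N) Z))"
    proof (clarsimp simp: finite_power_def)
      fix x z assume x: "x \<in> {..<Suc N} \<rightarrow>\<^sub>E Y" and z: "z \<in> topspace Z"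
      show "(x, z) \<in> ?f ` (Y \<times> ({..<N} \<rightarrow>\<^sub>E Y) \<times> topspace Z)"
      proof (rule image_eqI[of _ _ "(x N, restrict x {..<N}, z)"])
        have "(restrict x {..<N})(N := x N) = x"
          using x by (auto simp: fun_eq_iff PiE_def extensional_def restrict_def)
        then show "(x, z) = ?f (x N, restrict x {..<N}, z)" by simp
        show "(x N, restrict x {..<N}, z) \<in> Y \<times> ({..<N} \<rightarrow>\<^sub>E Y) \<times> topspace Z"
          using x z by (auto simp: PiE_def)
      qed
    qed
  qed
qed

text \<open>A one-point space serves as the auxiliary factor.\<close>

lemma hurewicz_covering_power:
  fixes Y :: "'a::topological_space set"
  assumes step: "\<And>W :: ((nat \<Rightarrow> 'a) \<times> unit) topology.
      hurewicz_covering W \<Longrightarrow> hurewicz_covering (prod_topology (top_of_set Y) W)"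
  shows "hurewicz_covering (finite_power Y N)"
proof -
  have "hurewicz_covering (discrete_topology {()})"
  proof (rule hurewicz_coveringI)
    fix V :: "nat \<Rightarrow> nat \<Rightarrow> unit set"
    assume "\<And>n x. x \<in> topspace (discrete_topology {()}) \<Longrightarrow> \<exists>m. x \<in> V n m"
    then have "\<forall>n. \<exists>m. () \<in> V n m" by simp
    then obtain g where "\<forall>n. () \<in> V n (g n)" by metis
    then show "\<exists>g. \<forall>x\<in>topspace (discrete_topology {()}). \<forall>\<^sub>F n in sequentially. x \<in> V n (g n)"
      by (intro exI[of _ g]) auto
  qed
  then have "hurewicz_covering (prod_topology (finite_power Y N) (discrete_topology {()}))"
    by (intro hurewicz_covering_prod_power step)
  then show ?thesis
    by (rule hurewicz_covering_continuous_image[OF _ continuous_map_fst]) auto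
qed

section \<open>Scales\<close>

lemma Card_order_bounding_number: "Card_order bounding_number"
  using bounding_number_is card_of_Card_order unfolding is_bounding_number_def by metis

lemma bounded_star_if_card_less:
  assumes "(card_of Y, bounding_number) \<in> ordLess"
  shows "bounded_star Y"
  using assms bounding_number_is not_ordLess_ordLeq unfolding is_bounding_number_def by blast

lemma family_bounded_if_card_less:
  fixes G :: "'i \<Rightarrow> nat \<Rightarrow> nat"
  assumes "(card_of I, bounding_number) \<in> ordLess"
  obtains g where "\<And>i. i \<in> I \<Longrightarrow> \<forall>\<^sub>F n in sequentially. G i n \<le> g n"
proof -
  have "bounded_star (G ` I)"
    using bounded_star_if_card_less ordLeq_ordLess_trans[OF card_of_image assms] by blast
  then show ?thesis
    using that unfolding bounded_star_def le_star_def cofinite_eq_sequentially by blast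
qed

section \<open>Neighbourhoods of sequences with infinite values, and truncation\<close>

lemma enat_infinity_nhd:
  assumes "open U" "\<infinity> \<in> (U :: enat set)"
  obtains t where "\<And>y. enat t \<le> y \<Longrightarrow> y \<in> U"
proof -
  obtain b where b: "b < \<infinity>" "{b<..\<infinity>} \<subseteq> U"
    using open_left[OF assms, of 0] by auto
  then obtain c where c: "b = enat c" by (cases b) auto
  show ?thesis
  proof (rule that[of "Suc c"])
    fix y assume "enat (Suc c) \<le> y"
    then have "b < y" using c by (meson enat_ord_simps(2) lessI order_less_le_trans)
    then show "y \<in> U" using b(2) by auto
  qed
qed

text \<open>A basic neighbourhood restricts only finitely many coordinates, so a single bound
  \<open>t\<close> serves all coordinates at which \<open>q\<close> is infinite; at the others
  agreement with \<open>q\<close> suffices.\<close>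

lemma enat_fun_nhd:
  assumes "open U" "q \<in> (U :: (nat \<Rightarrow> enat) set)"
  obtains t where "\<And>x. (\<And>i. if q i = \<infinity> then enat t \<le> x i else x i = q i) \<Longrightarrow> x \<in> U"
proof -
  obtain B where B: "q \<in> (\<Pi>\<^sub>E i\<in>UNIV. B i)" "\<And>i. openin euclidean (B i)"
      "finite {i. B i \<noteq> topspace euclidean}" "(\<Pi>\<^sub>E i\<in>UNIV. B i) \<subseteq> U"
    using product_topology_open_contains_basis[of "\<lambda>_. euclidean" UNIV U q] assms
    unfolding open_fun_def by blast
  have "\<exists>t. q i = \<infinity> \<longrightarrow> (\<forall>y\<ge>enat t. y \<in> B i)" for i
    using B(1) enat_infinity_nhd[of "B i"] B(2)[of i] by (metis PiE_mem UNIV_I open_openin)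
  then obtain t where t: "\<And>i y. q i = \<infinity> \<Longrightarrow> y \<ge> enat (t i) \<Longrightarrow> y \<in> B i" by metis
  define s where "s = Max (insert 0 (t ` {i. B i \<noteq> UNIV}))"
  have fin: "finite {i. B i \<noteq> UNIV}" using B(3) by simp
  show ?thesis
  proof (rule that[of s])
    fix x assume x: "\<And>i. if q i = \<infinity> then enat s \<le> x i else x i = q i"
    have "x i \<in> B i" for i
    proof (cases "q i = \<infinity> \<and> B i \<noteq> UNIV")
      case True
      then have "t i \<le> s" unfolding s_def using fin by (intro Max_ge) auto
      moreover have "enat s \<le> x i" using x[of i] True by simp
      ultimately show ?thesis using t[of i "x i"] True by (meson enat_ord_simps(1) order_trans)
    next
      case False
      then show ?thesis using x[of i] PiE_mem[OF B(1), of i] by (cases "q i = \<infinity>") auto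
    qed
    then show "x \<in> U" using B(4) by auto
  qed
qed

text \<open>The point of \<open>increasing_enat_inf\<close> that approximates \<open>x\<close> at
  level \<open>k\<close>: if \<open>x\<close> omits all values from \<open>k\<close> up to a large
  \<open>t\<close>, it lies in a prescribed neighbourhood of this truncation.\<close>

definition truncate_at :: "nat \<Rightarrow> (nat \<Rightarrow> enat) \<Rightarrow> nat \<Rightarrow> enat"
  where "truncate_at k x = (\<lambda>i. if x i < enat k then x i else \<infinity>)"

lemma increasing_enat_ge:
  assumes "x \<in> increasing_enat"
  shows "enat n \<le> x n"
proof (induction n)
  case (Suc n)
  show ?case
  proof (cases "x n")
    case (enat m)
    then have "x n < x (Suc n)" using assms by (auto simp: increasing_enat_def)
    then show ?thesis using Suc enat by (cases "x (Suc n)") auto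
  next
    case infinity
    moreover have "x n \<le> x (Suc n)" using assms by (auto simp: increasing_enat_def mono_def)
    ultimately show ?thesis by simp
  qed
qed (simp add: zero_enat_def[symmetric])

lemma truncate_at_in:
  assumes x: "x \<in> increasing_enat"
  shows "truncate_at k x \<in> increasing_enat_inf"
proof -
  have m: "mono x" and s: "\<And>n. x n < \<infinity> \<Longrightarrow> x n < x (Suc n)"
    using x by (auto simp: increasing_enat_def)
  have "mono (truncate_at k x)"
  proof (rule monoI)
    fix i j :: nat assume "i \<le> j"
    then have "x i \<le> x j" using m by (simp add: mono_def)
    then show "truncate_at k x i \<le> truncate_at k x j" by (auto simp: truncate_at_def)
  qed
  moreover have "truncate_at k x n < truncate_at k x (Suc n)" if "truncate_at k x n < \<infinity>" for n
    using that s[of n] by (auto simp: truncate_at_def split: if_splits)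
  moreover have "truncate_at k x k = \<infinity>"
    using increasing_enat_ge[OF x, of k] by (auto simp: truncate_at_def)
  ultimately show ?thesis unfolding increasing_enat_inf_def increasing_enat_def by blast
qed

text \<open>Since \<open>x n\<close> is at least \<open>n\<close>, a value below \<open>k\<close>
  can only occur at a position below \<open>k\<close>.\<close>

lemma finite_truncations: "finite (truncate_at k ` increasing_enat)"
proof (rule finite_subset)
  let ?D = "{f :: nat \<Rightarrow> enat. \<forall>i. (i \<in> {..<k} \<longrightarrow> f i \<in> insert \<infinity> (enat ` {..<k})) \<and> (i \<notin> {..<k} \<longrightarrow> f i = \<infinity>)}"
  show "finite ?D" by (rule finite_set_of_finite_funs) auto
  show "truncate_at k ` increasing_enat \<subseteq> ?D"
  proof clarify
    fix x i assume x: "x \<in> increasing_enat"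
    have "truncate_at k x i \<in> insert \<infinity> (enat ` {..<k})"
      by (cases "x i") (auto simp: truncate_at_def)
    moreover have "truncate_at k x i = \<infinity>" if "k \<le> i"
    proof -
      have "enat k \<le> x i" using increasing_enat_ge[OF x, of i] that
        by (meson enat_ord_simps(1) order_trans)
      then show ?thesis by (simp add: truncate_at_def leD)
    qed
    ultimately show "(i \<in> {..<k} \<longrightarrow> truncate_at k x i \<in> insert \<infinity> (enat ` {..<k})) \<and>
        (i \<notin> {..<k} \<longrightarrow> truncate_at k x i = \<infinity>)" by auto
  qed
qed

lemma countable_increasing_enat_inf: "countable increasing_enat_inf"
proof (rule countable_subset)
  show "countable (\<Union>k. truncate_at k ` increasing_enat)"
    using finite_truncations by (intro countable_UN) (auto intro: countable_finite)
  show "increasing_enat_inf \<subseteq> (\<Union>k. truncate_at k ` increasing_enat)"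
  proof
    fix q assume "q \<in> increasing_enat_inf"
    then obtain n where q: "q \<in> increasing_enat" and n: "q n = \<infinity>"
      by (auto simp: increasing_enat_inf_def)
    \<comment> \<open>This \<open>k\<close> exceeds all finite values of \<open>q\<close>, which
      occur before position \<open>n\<close>; truncating there leaves \<open>q\<close>
      unchanged.\<close>
    define k where "k = Suc (\<Sum>i<n. the_enat (q i))"
    have "q i < enat k" if "q i \<noteq> \<infinity>" for i
    proof -
      have "i < n"
      proof (rule ccontr)
        assume "\<not> i < n"
        then have "q n \<le> q i" using q by (auto simp: increasing_enat_def mono_def)
        then show False using n that by simp
      qed
      then have "the_enat (q i) < k" unfolding k_def less_Suc_eq_le
        by (intro member_le_sum) auto
      then show ?thesis using that by auto
    qed
    then have "truncate_at k q = q" unfolding truncate_at_def by (intro ext) (metis (full_types))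
    then show "q \<in> (\<Union>k. truncate_at k ` increasing_enat)" using q by (metis UN_I UNIV_I imageI)
  qed
qed

lemma strict_mono_in_increasing_enat:
  assumes "strict_mono f"
  shows "enat \<circ> f \<in> increasing_enat"
  using assms by (auto simp: increasing_enat_def mono_def strict_mono_less_eq strict_mono_Suc_iff)

text \<open>A pigeonhole count: the \<open>l\<close> values below \<open>x l\<close> cannot meet all of the \<open>l + 1\<close> intervals.\<close>

lemma strict_mono_gap:
  fixes x e :: "nat \<Rightarrow> nat"
  assumes x: "strict_mono x" and e: "strict_mono e" and l: "e (Suc (2 * l)) \<le> x l"
  obtains j where "l \<le> j" "j \<le> 2 * l" "\<And>i. x i < e j \<or> e (Suc j) \<le> x i"
proof (rule ccontr)
  assume "\<not> thesis"
  then have "\<forall>j\<in>{l..2*l}. \<exists>i. e j \<le> x i \<and> x i < e (Suc j)"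
    using that by (metis atLeastAtMost_iff not_le)
  then obtain p where p: "\<And>j. j \<in> {l..2*l} \<Longrightarrow> e j \<le> x (p j) \<and> x (p j) < e (Suc j)" by metis
  have "inj_on p {l..2*l}"
  proof (rule linorder_inj_onI)
    fix i j assume ij: "i < j" "i \<in> {l..2*l}" "j \<in> {l..2*l}"
    then have "x (p i) < e (Suc i)" "e (Suc i) \<le> e j" "e j \<le> x (p j)"
      using p e by (auto simp: strict_mono_less_eq)
    then show "p i \<noteq> p j" by auto
  qed auto
  moreover have "p ` {l..2*l} \<subseteq> {..<l}"
  proof clarify
    fix j assume j: "j \<in> {l..2*l}"
    then have "x (p j) < e (Suc j)" "e (Suc j) \<le> e (Suc (2*l))"
      using p e by (auto simp: strict_mono_less_eq)
    then have "x (p j) < x l" using l by linarith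
    then show "p j < l" using x by (simp add: strict_mono_less)
  qed
  ultimately have "card {l..2*l} \<le> card {..<l}"
    by (intro card_inj_on_le) auto
  then show False by simp
qed

text \<open>Having the same truncation fixes the values below \<open>k\<close>, and the gap from
  \<open>k\<close> to \<open>t\<close> pushes all other values up to \<open>t\<close>. This is
  exactly what \<open>enat_fun_nhd\<close> asks for near the truncation.\<close>

lemma truncation_nhd:
  assumes V: "openin (prod_topology (top_of_set X) Z) V"
    and q: "truncate_at k x \<in> X" "(truncate_at k x, y) \<in> V"
  obtains t B where "openin Z B" "y \<in> B"
    "\<And>x' y'. \<lbrakk>x' \<in> X; truncate_at k x' = truncate_at k x; \<And>i. x' i < enat k \<or> enat t \<le> x' i; y' \<in> B\<rbrakk> \<Longrightarrow> (x', y') \<in> V"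
proof -
  obtain A B where AB: "openin (top_of_set X) A" "openin Z B" "truncate_at k x \<in> A" "y \<in> B" "A \<times> B \<subseteq> V"
    using V q(2) unfolding openin_prod_topology_alt by meson
  obtain U where U: "open U" "A = X \<inter> U" using AB(1) by (auto simp: openin_open)
  obtain t where t: "\<And>x'. (\<And>i. if truncate_at k x i = \<infinity> then enat t \<le> x' i else x' i = truncate_at k x i) \<Longrightarrow> x' \<in> U"
    using enat_fun_nhd[OF U(1), of "truncate_at k x"] AB(3) U(2) by auto
  show ?thesis
  proof (rule that[OF AB(2,4)])
    fix x' y' assume x': "x' \<in> X" "truncate_at k x' = truncate_at k x"
      "\<And>i. x' i < enat k \<or> enat t \<le> x' i" "y' \<in> B"
    have "x' \<in> U"
    proof (rule t)
      fix i
      have "truncate_at k x i = (if x' i < enat k then x' i else \<infinity>)"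
        using fun_cong[OF x'(2), of i] by (simp add: truncate_at_def)
      then show "if truncate_at k x i = \<infinity> then enat t \<le> x' i else x' i = truncate_at k x i"
        using x'(3)[of i] by (cases "x' i") auto
    qed
    then show "(x', y') \<in> V" using AB(5) U(2) x'(1,4) by blast
  qed
qed

text \<open>There are only finitely many truncations at level \<open>k\<close>, so their bounds have
  a maximum and their neighbourhoods of \<open>y\<close> an open intersection. The number
  \<open>t\<close> is both the end of the gap and the index into \<open>V\<close>, which leaves a
  single number to be selected by the Hurewicz property of \<open>Z\<close>.\<close>

lemma uniform_truncation_nhd:
  fixes V :: "nat \<Rightarrow> ((nat \<Rightarrow> enat) \<times> 'b) set"
  assumes X: "increasing_enat_inf \<subseteq> X" "X \<subseteq> increasing_enat"
    and V: "\<And>m. openin (prod_topology (top_of_set X) Z) (V m)" "\<And>i j. i \<le> j \<Longrightarrow> V i \<subseteq> V j"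
      "\<And>x. x \<in> X \<Longrightarrow> \<exists>m. (x, y) \<in> V m"
    and y: "y \<in> topspace Z"
  shows "\<exists>t B. openin Z B \<and> y \<in> B \<and>
    (\<forall>x\<in>X. \<forall>y'\<in>B. (\<forall>i. x i < enat k \<or> enat t \<le> x i) \<longrightarrow> (x, y') \<in> V t)"
proof -
  let ?Q = "truncate_at k ` increasing_enat"
  have "\<exists>t B. openin Z B \<and> y \<in> B \<and>
    (\<forall>x\<in>X. \<forall>y'\<in>B. truncate_at k x = q \<longrightarrow> (\<forall>i. x i < enat k \<or> enat t \<le> x i) \<longrightarrow> (x, y') \<in> V t)"
    if hq: "q \<in> ?Q" for q
  proof -
    obtain x where x: "x \<in> increasing_enat" "q = truncate_at k x" using hq by blast
    then have qX: "truncate_at k x \<in> X" using truncate_at_in X(1) by blast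
    obtain m where m: "(truncate_at k x, y) \<in> V m" using V(3)[OF qX] by blast
    obtain t B where tB: "openin Z B" "y \<in> B"
      "\<And>x' y'. \<lbrakk>x' \<in> X; truncate_at k x' = truncate_at k x; \<And>i. x' i < enat k \<or> enat t \<le> x' i; y' \<in> B\<rbrakk> \<Longrightarrow> (x', y') \<in> V m"
      using truncation_nhd[OF V(1) qX m] by metis
    show ?thesis
    proof (rule exI[of _ "max t m"], rule exI[of _ B], intro conjI ballI impI tB(1,2))
      fix x' y' assume a: "x' \<in> X" "y' \<in> B" "truncate_at k x' = q" "\<forall>i. x' i < enat k \<or> enat (max t m) \<le> x' i"
      have "x' i < enat k \<or> enat t \<le> x' i" for i
        using a(4) by (meson enat_ord_simps(1) max.cobounded1 order_trans)
      then have "(x', y') \<in> V m" using tB(3) a x(2) by blast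
      then show "(x', y') \<in> V (max t m)" using V(2)[of m "max t m"] by auto
    qed
  qed
  then obtain t B where tB: "\<And>q. q \<in> ?Q \<Longrightarrow> openin Z (B q) \<and> y \<in> B q \<and>
    (\<forall>x\<in>X. \<forall>y'\<in>B q. truncate_at k x = q \<longrightarrow> (\<forall>i. x i < enat k \<or> enat (t q) \<le> x i) \<longrightarrow> (x, y') \<in> V (t q))"
    by metis
  define s where "s = Max (insert 0 (t ` ?Q))"
  have ts: "t q \<le> s" if "q \<in> ?Q" for q
    unfolding s_def using that finite_truncations by (intro Max_ge) auto
  show ?thesis
  proof (rule exI[of _ s], rule exI[of _ "topspace Z \<inter> \<Inter>(B ` ?Q)"], intro conjI ballI impI)
    show "openin Z (topspace Z \<inter> \<Inter>(B ` ?Q))"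
    proof (cases "?Q = {}")
      case False
      then show ?thesis using finite_truncations tB by (intro openin_Int openin_Inter) auto
    qed simp
    show "y \<in> topspace Z \<inter> \<Inter>(B ` ?Q)" using y tB by blast
    fix x y' assume a: "x \<in> X" "y' \<in> topspace Z \<inter> \<Inter>(B ` ?Q)" "\<forall>i. x i < enat k \<or> enat s \<le> x i"
    have q: "truncate_at k x \<in> ?Q" using a(1) X(2) by blast
    have "x i < enat k \<or> enat (t (truncate_at k x)) \<le> x i" for i
      using a(3) ts[OF q] by (meson enat_ord_simps(1) order_trans)
    moreover have "y' \<in> B (truncate_at k x)" using a(2) q by blast
    ultimately have "(x, y') \<in> V (t (truncate_at k x))" using tB[OF q] a(1) by blast
    then show "(x, y') \<in> V s" using V(2)[OF ts[OF q]] by blast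
  qed
qed

section \<open>Products of the scale set with a Hurewicz space\<close>

lemma hurewicz_covering_section:
  fixes V :: "nat \<Rightarrow> nat \<Rightarrow> ('a \<times> 'b) set"
  assumes Z: "hurewicz_covering Z" and x: "x \<in> topspace T"
    and V: "\<And>n m. openin (prod_topology T Z) (V n m)" "\<And>n i j. i \<le> j \<Longrightarrow> V n i \<subseteq> V n j"
      "\<And>n y. y \<in> topspace Z \<Longrightarrow> \<exists>m. (x, y) \<in> V n m"
  shows "\<exists>g. \<forall>y\<in>topspace Z. \<forall>\<^sub>F n in sequentially. (x, y) \<in> V n (g n)"
proof -
  obtain g where g: "\<And>y. y \<in> topspace Z \<Longrightarrow> \<forall>\<^sub>F n in sequentially. y \<in> {y \<in> topspace Z. (x, y) \<in> V n (g n)}"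
  proof (rule hurewicz_coveringD[OF Z, where V = "\<lambda>n m. {y \<in> topspace Z. (x, y) \<in> V n m}"])
    have "continuous_map Z (prod_topology T Z) (\<lambda>y. (x, y))"
      using x by (intro continuous_map_pairedI) auto
    then show "openin Z {y \<in> topspace Z. (x, y) \<in> V n m}" for n m
      using openin_continuous_map_preimage V(1) by fastforce
  qed (use V in blast)+
  show ?thesis
  proof (intro exI ballI)
    fix y assume "y \<in> topspace Z"
    from g[OF this] show "\<forall>\<^sub>F n in sequentially. (x, y) \<in> V n (g n)"
      by eventually_elim simp
  qed
qed

theorem hurewicz_covering_scale_times:
  fixes Z :: "'b topology"
  assumes S: "b_scale S" and Z: "hurewicz_covering Z"
  shows "hurewicz_covering (prod_topology (top_of_set ((\<lambda>f. enat \<circ> f) ` S \<union> increasing_enat_inf)) Z)"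
proof (rule hurewicz_coveringI)
  define X where "X = (\<lambda>f. enat \<circ> f) ` S \<union> increasing_enat_inf"
  fix V :: "nat \<Rightarrow> nat \<Rightarrow> ((nat \<Rightarrow> enat) \<times> 'b) set"
  assume V0: "\<And>n m. openin (prod_topology (top_of_set ((\<lambda>f. enat \<circ> f) ` S \<union> increasing_enat_inf)) Z) (V n m)"
     "\<And>n i j. i \<le> j \<Longrightarrow> V n i \<subseteq> V n j"
     "\<And>n x. x \<in> topspace (prod_topology (top_of_set ((\<lambda>f. enat \<circ> f) ` S \<union> increasing_enat_inf)) Z) \<Longrightarrow> \<exists>m. x \<in> V n m"
  have V: "\<And>n m. openin (prod_topology (top_of_set X) Z) (V n m)"
     "\<And>n i j. i \<le> j \<Longrightarrow> V n i \<subseteq> V n j"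
     "\<And>n x y. x \<in> X \<Longrightarrow> y \<in> topspace Z \<Longrightarrow> \<exists>m. (x, y) \<in> V n m"
    using V0 by (auto simp: X_def)
  have SM: "\<And>f. f \<in> S \<Longrightarrow> strict_mono f" and unb: "\<not> bounded_star S"
    using S by (simp_all add: b_scale_def)
  have "\<exists>F. S = F ` Field bounding_number \<and>
      (\<forall>\<alpha> \<beta>. (\<alpha>, \<beta>) \<in> bounding_number \<and> \<alpha> \<noteq> \<beta> \<longrightarrow> F \<alpha> \<le>* F \<beta>)"
    using S by (simp add: b_scale_def)
  then obtain F where SF: "S = F ` Field bounding_number"
    and F: "\<And>\<alpha> \<beta>. (\<alpha>, \<beta>) \<in> bounding_number \<Longrightarrow> \<alpha> \<noteq> \<beta> \<Longrightarrow> F \<alpha> \<le>* F \<beta>"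
    by (elim exE conjE) simp
  have Xi: "X \<subseteq> increasing_enat" "increasing_enat_inf \<subseteq> X"
    using SM strict_mono_in_increasing_enat by (auto simp: X_def increasing_enat_inf_def)
  \<comment> \<open>The points near which a gap from \<open>k\<close> to \<open>t\<close> in
    \<open>x\<close> is enough to land in \<open>V n t\<close>. For fixed \<open>n\<close> and
    \<open>k\<close> these sets are open, increase with \<open>t\<close> and cover \<open>Z\<close>;
    the Hurewicz property is applied to all pairs \<open>(n, k)\<close> at once through the pairing
    function.\<close>
  define W where "W n k t = {y \<in> topspace Z. \<exists>B. openin Z B \<and> y \<in> B \<and>
    (\<forall>x\<in>X. \<forall>y'\<in>B. (\<forall>i. x i < enat k \<or> enat t \<le> x i) \<longrightarrow> (x, y') \<in> V n t)}" for n k t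
  obtain t' where t': "\<And>y. y \<in> topspace Z \<Longrightarrow>
      \<forall>\<^sub>F N in sequentially. y \<in> W (fst (prod_decode N)) (snd (prod_decode N)) (t' N)"
  proof (rule hurewicz_coveringD[OF Z, where V = "\<lambda>N. W (fst (prod_decode N)) (snd (prod_decode N))"])
    show "openin Z (W (fst (prod_decode N)) (snd (prod_decode N)) m)" for N m
    proof (subst openin_subopen, intro ballI)
      fix y assume "y \<in> W (fst (prod_decode N)) (snd (prod_decode N)) m"
      then obtain B where B: "openin Z B" "y \<in> B" "\<forall>x\<in>X. \<forall>y'\<in>B.
          (\<forall>i. x i < enat (snd (prod_decode N)) \<or> enat m \<le> x i) \<longrightarrow> (x, y') \<in> V (fst (prod_decode N)) m"
        unfolding W_def by blast
      moreover have "B \<subseteq> W (fst (prod_decode N)) (snd (prod_decode N)) m"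
        using B openin_subset[OF B(1)] unfolding W_def by blast
      ultimately show "\<exists>T. openin Z T \<and> y \<in> T \<and> T \<subseteq> W (fst (prod_decode N)) (snd (prod_decode N)) m"
        by blast
    qed
    show "W (fst (prod_decode N)) (snd (prod_decode N)) i \<subseteq> W (fst (prod_decode N)) (snd (prod_decode N)) j"
      if ij: "i \<le> j" for N i j
    proof -
      have "W n k i \<subseteq> W n k j" for n k
      proof
        fix y assume "y \<in> W n k i"
        then obtain B where B: "y \<in> topspace Z" "openin Z B" "y \<in> B"
          "\<And>x y'. \<lbrakk>x \<in> X; y' \<in> B; \<forall>l. x l < enat k \<or> enat i \<le> x l\<rbrakk> \<Longrightarrow> (x, y') \<in> V n i"
          unfolding W_def by blast
        have "(x, y') \<in> V n j" if x: "x \<in> X" "y' \<in> B" and gap: "\<forall>l. x l < enat k \<or> enat j \<le> x l" for x y'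
        proof -
          have "\<forall>l. x l < enat k \<or> enat i \<le> x l"
            using gap ij by (meson enat_ord_simps(1) order_trans)
          then show ?thesis using B(4)[OF x] V(2)[OF ij] by blast
        qed
        then show "y \<in> W n k j" unfolding W_def using B(1-3) by blast
      qed
      then show ?thesis by blast
    qed
    show "\<exists>m. y \<in> W (fst (prod_decode N)) (snd (prod_decode N)) m" if y: "y \<in> topspace Z" for N y
      using uniform_truncation_nhd[OF Xi(2,1) V(1) V(2) V(3)[OF _ y] y] y unfolding W_def by simp
  qed (erule that)
  define t where "t n k = t' (prod_encode (n, k))" for n k
  \<comment> \<open>Only finitely many codes fail for \<open>y\<close>. As the code of
    \<open>(n, k)\<close> is at least \<open>n\<close>, a large \<open>n\<close> avoids them all,
    uniformly in \<open>k\<close>.\<close>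
  have t: "\<exists>N. \<forall>n\<ge>N. \<forall>k. y \<in> W n k (t n k)" if y: "y \<in> topspace Z" for y
  proof -
    obtain N where N: "\<And>M. M \<ge> N \<Longrightarrow> y \<in> W (fst (prod_decode M)) (snd (prod_decode M)) (t' M)"
      using t'[OF y] by (auto simp: eventually_sequentially)
    have "y \<in> W n k (t n k)" if "n \<ge> N" for n k
      using N[of "prod_encode (n, k)"] le_prod_encode_1[of n k] that by (simp add: t_def)
    then show ?thesis by blast
  qed
  \<comment> \<open>\<open>M k\<close> exceeds \<open>k\<close> and bounds \<open>t n k\<close> for
    all \<open>n\<close> up to \<open>k\<close>. Its iterates cut the natural numbers into intervals
    from \<open>e j\<close> to \<open>e (Suc j)\<close>, each long enough to be a gap at level
    \<open>e j\<close> for every \<open>n\<close> up to \<open>e j\<close>.\<close>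
  define M where "M k = Suc k + (\<Sum>n\<le>k. t n k)" for k
  define e where "e j = (M ^^ j) 0" for j
  have e: "strict_mono e" by (simp add: strict_mono_Suc_iff e_def M_def)
  have tM: "t n k \<le> M k" if "n \<le> k" for n k
    using member_le_sum[of n "{..k}" "\<lambda>n. t n k"] that by (simp add: M_def)
  \<comment> \<open>The lower bound on \<open>x l\<close> from which \<open>strict_mono_gap\<close>
    obtains an interval, with index between \<open>l\<close> and \<open>2 * l\<close>, that contains
    no value of \<open>x\<close>.\<close>
  define h where "h l = e (Suc (2 * l))" for l
  obtain b where b: "b \<in> Field bounding_number" "\<not> F b \<le>* h"
    using unb SF unfolding bounded_star_def by blast
  \<comment> \<open>\<open>F b\<close> exceeds \<open>h\<close> at infinitely many arguments, and
    \<open>L n\<close> is the first of them from \<open>n\<close> on. It depends on \<open>b\<close>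
    alone, which makes the later bound the same for all members of the scale above
    \<open>F b\<close>.\<close>
  define L where "L n = (LEAST l. n \<le> l \<and> h l < F b l)" for n
  have L: "n \<le> L n" "h (L n) < F b (L n)" for n
  proof -
    have "\<exists>l. n \<le> l \<and> h l < F b l"
      using b(2) unfolding le_star_def cofinite_eq_sequentially eventually_sequentially
      by (metis not_le)
    from LeastI_ex[OF this] show "n \<le> L n" "h (L n) < F b (L n)" by (auto simp: L_def)
  qed
  \<comment> \<open>The index \<open>j\<close> of the empty interval depends on \<open>F a\<close>,
    but it is at most \<open>2 * L n\<close>; summing over all candidates removes the
    dependence.\<close>
  define g1 where "g1 n = (\<Sum>j\<le>2 * L n. t n (e j))" for n
  have late: "\<forall>\<^sub>F n in sequentially. (enat \<circ> F a, y) \<in> V n (g1 n)"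
    if a: "F a \<in> S" "F b \<le>* F a" and y: "y \<in> topspace Z" for a y
  proof -
    obtain N where N: "\<And>n k. n \<ge> N \<Longrightarrow> y \<in> W n k (t n k)" using t[OF y] by blast
    obtain m where m: "\<And>l. l \<ge> m \<Longrightarrow> F b l \<le> F a l"
      using a(2) unfolding le_star_def cofinite_eq_sequentially eventually_sequentially by blast
    show ?thesis
      using eventually_ge_at_top[of N] eventually_ge_at_top[of m]
    proof eventually_elim
      case (elim n)
      have "F b (L n) \<le> F a (L n)" using m L(1)[of n] elim(2) by simp
      then have "e (Suc (2 * L n)) \<le> F a (L n)" using L(2)[of n] by (simp add: h_def)
      from strict_mono_gap[OF SM[OF a(1)] e this]
      obtain j where j: "L n \<le> j" "j \<le> 2 * L n" "\<And>i. F a i < e j \<or> e (Suc j) \<le> F a i" by blast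
      \<comment> \<open>As \<open>n\<close> is at most \<open>e j\<close>, the number
        \<open>M (e j)\<close>, which is \<open>e (Suc j)\<close>, bounds \<open>t n (e j)\<close>:
        the interval omitted by \<open>F a\<close> is a sufficient gap.\<close>
      have "n \<le> e j" using strict_mono_imp_increasing[OF e, of j] j(1) L(1)[of n] by linarith
      then have "t n (e j) \<le> e (Suc j)" using tM by (simp add: e_def)
      then have "\<forall>i. (enat \<circ> F a) i < enat (e j) \<or> enat (t n (e j)) \<le> (enat \<circ> F a) i"
        using j(3) by (auto intro: order_trans)
      moreover have "y \<in> W n (e j) (t n (e j))" using N elim(1) by blast
      moreover have "enat \<circ> F a \<in> X" using a(1) by (simp add: X_def)
      ultimately have "(enat \<circ> F a, y) \<in> V n (t n (e j))" unfolding W_def by blast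
      moreover have "t n (e j) \<le> g1 n" unfolding g1_def using j(2) by (intro member_le_sum) auto
      ultimately show ?case using V(2) by blast
    qed
  qed
  have "\<exists>g. \<forall>y\<in>topspace Z. \<forall>\<^sub>F n in sequentially. (x, y) \<in> V n (g n)" if "x \<in> X" for x
    by (rule hurewicz_covering_section[OF Z, of _ "top_of_set X"]) (use V that in auto)
  then obtain G where G: "\<And>x y. x \<in> X \<Longrightarrow> y \<in> topspace Z \<Longrightarrow> \<forall>\<^sub>F n in sequentially. (x, y) \<in> V n (G x n)"
    by metis
  \<comment> \<open>Each member of the scale before \<open>b\<close> has its own bound over
    \<open>Z\<close>; there are fewer than \<bb> of them, so these bounds are themselves
    bounded.\<close>
  have "(card_of (underS bounding_number b), bounding_number) \<in> ordLess"
    using card_of_underS[OF Card_order_bounding_number b(1)] .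
  then obtain g2 where g2: "\<And>a. a \<in> underS bounding_number b \<Longrightarrow> \<forall>\<^sub>F n in sequentially. G (enat \<circ> F a) n \<le> g2 n"
    using family_bounded_if_card_less[of _ "\<lambda>a. G (enat \<circ> F a)"] by blast
  obtain g3 where g3: "\<And>i. \<forall>\<^sub>F n in sequentially. G (from_nat_into increasing_enat_inf i) n \<le> g3 n"
    using countable_bounded_star[of "\<lambda>i. G (from_nat_into increasing_enat_inf i)"] by blast
  have lift: "\<forall>\<^sub>F n in sequentially. (x, y) \<in> V n (g1 n + g2 n + g3 n)"
    if "\<forall>\<^sub>F n in sequentially. (x, y) \<in> V n (g n)" "\<forall>\<^sub>F n in sequentially. g n \<le> g1 n + g2 n + g3 n" for x y g
    using that by eventually_elim (use V(2) in blast)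
  have "\<forall>\<^sub>F n in sequentially. (x, y) \<in> V n (g1 n + g2 n + g3 n)" if x: "x \<in> X" and y: "y \<in> topspace Z" for x y
  proof (cases "x \<in> increasing_enat_inf")
    case True
    then have "from_nat_into increasing_enat_inf (to_nat_on increasing_enat_inf x) = x"
      using countable_increasing_enat_inf by simp
    with g3[of "to_nat_on increasing_enat_inf x"] have "\<forall>\<^sub>F n in sequentially. G x n \<le> g3 n" by simp
    then have "\<forall>\<^sub>F n in sequentially. G x n \<le> g1 n + g2 n + g3 n" by eventually_elim simp
    with G[OF x y] show ?thesis by (rule lift)
  next
    case False
    then obtain a where a: "a \<in> Field bounding_number" "x = enat \<circ> F a" using x SF by (auto simp: X_def)
    show ?thesis
    proof (cases "a \<in> underS bounding_number b")
      case True
      from g2[OF this] have "\<forall>\<^sub>F n in sequentially. G x n \<le> g1 n + g2 n + g3 n"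
        unfolding a(2) by eventually_elim simp
      with G[OF x y] show ?thesis by (rule lift)
    next
      case False
      have "F b \<le>* F a"
      proof (cases "a = b")
        case True
        then show ?thesis by (simp add: le_star_def)
      next
        case ab: False
        have "Total bounding_number"
          using Card_order_bounding_number by (auto simp: card_order_on_def well_order_on_def linear_order_on_def)
        then have "(b, a) \<in> bounding_number"
          using ab False a(1) b(1) by (auto simp: total_on_def underS_def)
        then show ?thesis using F ab by blast
      qed
      then have "\<forall>\<^sub>F n in sequentially. (x, y) \<in> V n (g1 n)" using late[of a y] a SF y by auto
      then show ?thesis by (rule lift) simp
    qed
  qed
  then show "\<exists>g. \<forall>x\<in>topspace (prod_topology (top_of_set ((\<lambda>f. enat \<circ> f) ` S \<union> increasing_enat_inf)) Z).
      \<forall>\<^sub>F n in sequentially. x \<in> V n (g n)"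
    by (intro exI[of _ "\<lambda>n. g1 n + g2 n + g3 n"]) (auto simp: X_def)
qed

lemma continuous_map_prod_left:
  assumes "continuous_map T T' f"
  shows "continuous_map (prod_topology T W) (prod_topology T' W) (\<lambda>p. (f (fst p), snd p))"
  using continuous_map_compose[OF continuous_map_fst assms]
  by (intro continuous_map_pairedI continuous_map_snd) (simp add: o_def)

lemma hurewicz_covering_scale_set_times:
  fixes W :: "'b topology"
  assumes S: "b_scale S" and h: "homeomorphism increasing_enat C h h'" and W: "hurewicz_covering W"
  shows "hurewicz_covering (prod_topology (top_of_set (h ` ((\<lambda>f. enat \<circ> f) ` S \<union> increasing_enat_inf))) W)"
proof -
  let ?Y = "(\<lambda>f. enat \<circ> f) ` S \<union> increasing_enat_inf"
  have "?Y \<subseteq> increasing_enat"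
    using S strict_mono_in_increasing_enat by (auto simp: b_scale_def increasing_enat_inf_def)
  then have "continuous_on ?Y h"
    using h unfolding homeomorphism_def by (meson continuous_on_subset)
  then have "continuous_map (top_of_set ?Y) (top_of_set (h ` ?Y)) h"
    by (simp add: continuous_map_in_subtopology)
  then show ?thesis
    by (intro hurewicz_covering_continuous_image[OF hurewicz_covering_scale_times[OF S W] continuous_map_prod_left]) force+
qed

section \<open>Ideals with the Fubini property\<close>

text \<open>In \<open>fubini\<close> the set \<open>Z\<close> is arbitrary and only the relation
  \<open>B\<close> is Borel: the square of a set outside the ideal cannot be divided by a Borel set
  into a part with small vertical and a part with small horizontal sections. For well-orders with
  small initial segments this is the classical argument of Sierpinski.\<close>

locale fubini_ideal =
  fixes I :: "real set set"
  assumes countable_in: "\<And>A. countable A \<Longrightarrow> A \<in> I"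
    and subset_in: "\<And>A B. A \<in> I \<Longrightarrow> B \<subseteq> A \<Longrightarrow> B \<in> I"
    and Union_in: "\<And>\<A>. countable \<A> \<Longrightarrow> \<A> \<subseteq> I \<Longrightarrow> \<Union>\<A> \<in> I"
    and fubini: "\<And>B Z. B \<in> sets (borel \<Otimes>\<^sub>M borel) \<Longrightarrow> (\<And>z. z \<in> Z \<Longrightarrow> {w \<in> Z. (z, w) \<in> B} \<in> I) \<Longrightarrow>
      (\<And>w. w \<in> Z \<Longrightarrow> {z \<in> Z. (z, w) \<notin> B} \<in> I) \<Longrightarrow> Z \<in> I"
begin

lemma Un_in: "A \<in> I \<Longrightarrow> B \<in> I \<Longrightarrow> A \<union> B \<in> I"
  using Union_in[of "{A, B}"] by simp

lemma UN_in: "countable K \<Longrightarrow> (\<And>k. k \<in> K \<Longrightarrow> A k \<in> I) \<Longrightarrow> (\<Union>k\<in>K. A k) \<in> I"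
  using Union_in[of "A ` K"] by (simp add: image_subset_iff)

end

text \<open>Each level set of a coordinate is the trace on \<open>Z\<close> of a Borel set
  \<open>A n k\<close>. Combining these Borel sets gives a Borel set of the plane that describes the
  relation on the square of \<open>Z\<close>, although \<open>Z\<close> itself may be far from
  Borel.\<close>

lemma borel_le_star_relation:
  fixes f :: "real \<Rightarrow> nat \<Rightarrow> nat"
  assumes f: "\<And>n. (\<lambda>z. f z n) \<in> measurable (restrict_space borel Z) (count_space UNIV)"
  obtains B where "B \<in> sets (borel \<Otimes>\<^sub>M borel)"
    "\<And>z w. z \<in> Z \<Longrightarrow> w \<in> Z \<Longrightarrow> (z, w) \<in> B \<longleftrightarrow> f w \<le>* f z"
proof -
  have "\<exists>A\<in>sets borel. {z \<in> Z. f z n = k} = Z \<inter> A" for n k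
  proof -
    have "(\<lambda>z. f z n) -` {k} \<inter> space (restrict_space borel Z) \<in> sets (restrict_space borel Z)"
      using f by (rule measurable_sets) simp
    then obtain A where A: "A \<in> sets borel" "(\<lambda>z. f z n) -` {k} \<inter> Z = Z \<inter> A"
      by (auto simp: sets_restrict_space space_restrict_space)
    moreover have "{z \<in> Z. f z n = k} = (\<lambda>z. f z n) -` {k} \<inter> Z" by auto
    ultimately show ?thesis by auto
  qed
  then obtain A where A: "\<And>n k. A n k \<in> sets borel" "\<And>n k. {z \<in> Z. f z n = k} = Z \<inter> A n k"
    by metis
  \<comment> \<open>In the union, \<open>l\<close> is the value \<open>f z n\<close> and
    \<open>k\<close> is the value \<open>f w n\<close>.\<close>
  define B where "B = (\<Union>m. \<Inter>n\<in>{m..}. \<Union>l. \<Union>k\<in>{..l}. A n l \<times> A n k)"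
  show ?thesis
  proof (rule that)
    show "B \<in> sets (borel \<Otimes>\<^sub>M borel)"
      unfolding B_def using A(1)
      by (intro sets.countable_UN'' sets.countable_INT'' sets.countable_INT' sets.countable_UN' pair_measureI) auto
    fix z w assume z: "z \<in> Z" "w \<in> Z"
    have mem: "v \<in> A n k \<longleftrightarrow> f v n = k" if "v \<in> Z" for v n k
      using A(2)[of n k] that by blast
    have "(z, w) \<in> (\<Union>l. \<Union>k\<in>{..l}. A n l \<times> A n k) \<longleftrightarrow> f w n \<le> f z n" for n
      using mem z by auto
    then have "(z, w) \<in> B \<longleftrightarrow> (\<exists>m. \<forall>n\<ge>m. f w n \<le> f z n)"
      unfolding B_def by auto
    then show "(z, w) \<in> B \<longleftrightarrow> f w \<le>* f z"
      by (simp add: le_star_def cofinite_eq_sequentially eventually_sequentially)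
  qed
qed

lemma countable_eq_star_class:
  fixes g :: "nat \<Rightarrow> nat"
  shows "countable {f. f \<le>* g \<and> g \<le>* f}"
proof (rule countable_subset)
  let ?F = "\<lambda>m xs n. if n < m then xs ! n else g n"
  show "countable (\<Union>m. range (?F m))" by (intro countable_UN) auto
  show "{f. f \<le>* g \<and> g \<le>* f} \<subseteq> (\<Union>m. range (?F m))"
  proof clarify
    fix f assume "f \<le>* g" "g \<le>* f"
    then have "\<forall>\<^sub>F n in sequentially. f n = g n"
      unfolding le_star_def cofinite_eq_sequentially by eventually_elim simp
    then obtain m where m: "\<And>n. n \<ge> m \<Longrightarrow> f n = g n" by (auto simp: eventually_sequentially)
    have "f = ?F m (map f [0..<m])" using m by (auto simp: fun_eq_iff)
    then show "f \<in> (\<Union>m. range (?F m))" by blast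
  qed
qed

text \<open>
  Otherwise cut \<open>Z\<close> down to a set outside \<open>I\<close> all of whose initial segments are in \<open>I\<close>; the
  relation \<open>f w \<le>* f z\<close> then contradicts the Fubini property.
\<close>

lemma (in fubini_ideal) scale_valued_in:
  fixes f :: "real \<Rightarrow> nat \<Rightarrow> nat" and r :: "'i rel"
  assumes r: "Well_order r" and F: "\<And>\<alpha> \<beta>. (\<alpha>, \<beta>) \<in> r \<Longrightarrow> \<alpha> \<noteq> \<beta> \<Longrightarrow> F \<alpha> \<le>* F \<beta>"
    and fF: "f ` Z \<subseteq> F ` Field r"
    and f: "\<And>n. (\<lambda>z. f z n) \<in> measurable (restrict_space borel Z) (count_space UNIV)"
    and fibre: "\<And>g. {z \<in> Z. f z = g} \<in> I"
  shows "Z \<in> I"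
proof (rule ccontr)
  assume Z: "Z \<notin> I"
  have "\<forall>z\<in>Z. \<exists>\<alpha>. \<alpha> \<in> Field r \<and> f z = F \<alpha>" using fF by auto
  from bchoice[OF this] obtain a where a: "\<And>z. z \<in> Z \<Longrightarrow> a z \<in> Field r" "\<And>z. z \<in> Z \<Longrightarrow> f z = F (a z)"
    by auto
  have lin: "linear_order_on (Field r) r" and wf: "wf (r - Id)"
    using r by (simp_all add: well_order_on_def)
  have refl: "(\<alpha>, \<alpha>) \<in> r" if "\<alpha> \<in> Field r" for \<alpha>
    using lin that by (simp add: order_on_defs refl_on_def)
  have total: "(\<alpha>, \<beta>) \<in> r \<or> (\<beta>, \<alpha>) \<in> r" if "\<alpha> \<in> Field r" "\<beta> \<in> Field r" for \<alpha> \<beta>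
    using lin that refl by (cases "\<alpha> = \<beta>") (auto simp: order_on_defs total_on_def)
  have "\<exists>T\<subseteq>Z. T \<notin> I \<and> (\<forall>w\<in>T. {z \<in> Z. (a z, a w) \<in> r} \<in> I)"
  proof (cases "\<exists>\<beta>\<in>Field r. {z \<in> Z. (a z, \<beta>) \<in> r} \<notin> I")
    case False
    then show ?thesis using Z a(1) by blast
  next
    case True
    then obtain \<beta> where \<beta>: "\<beta> \<in> {\<beta> \<in> Field r. {z \<in> Z. (a z, \<beta>) \<in> r} \<notin> I}"
      and min: "\<And>\<gamma>. (\<gamma>, \<beta>) \<in> r - Id \<Longrightarrow> \<gamma> \<notin> {\<beta> \<in> Field r. {z \<in> Z. (a z, \<beta>) \<in> r} \<notin> I}"
      using wfE_min[OF wf, of _ "{\<beta> \<in> Field r. {z \<in> Z. (a z, \<beta>) \<in> r} \<notin> I}"] by blast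
    \<comment> \<open>The part of \<open>Z\<close> strictly before the least index with a large
      initial segment. Cutting off \<open>\<beta>\<close> itself removes only part of the fibre over
      \<open>F \<beta>\<close>, so the rest is still large.\<close>
    let ?T = "{z \<in> Z. (a z, \<beta>) \<in> r \<and> a z \<noteq> \<beta>}"
    have "{z \<in> Z. (a z, \<beta>) \<in> r} \<subseteq> ?T \<union> {z \<in> Z. f z = F \<beta>}" using a(2) by auto
    then have "?T \<notin> I" using \<beta> fibre Un_in subset_in by blast
    moreover have "{z \<in> Z. (a z, a w) \<in> r} \<in> I" if "w \<in> ?T" for w
      using min[of "a w"] a(1)[of w] that by blast
    ultimately show ?thesis by (intro exI[of _ ?T]) blast
  qed
  then obtain T where T: "T \<subseteq> Z" "T \<notin> I" "\<And>w. w \<in> T \<Longrightarrow> {z \<in> Z. (a z, a w) \<in> r} \<in> I" by blast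
  obtain B where B: "B \<in> sets (borel \<Otimes>\<^sub>M borel)"
    "\<And>z w. z \<in> Z \<Longrightarrow> w \<in> Z \<Longrightarrow> (z, w) \<in> B \<longleftrightarrow> f w \<le>* f z"
    by (rule borel_le_star_relation[OF f]) (rule that)
  have "T \<in> I"
  proof (rule fubini[OF B(1)])
    fix z assume z: "z \<in> T"
    \<comment> \<open>A later index may carry a function that is also eventually below
      \<open>f z\<close>. The two functions then differ at finitely many places only, so all such
      \<open>w\<close> lie in countably many fibres.\<close>
    have "(\<Union>g\<in>{g. g \<le>* f z \<and> f z \<le>* g}. {w \<in> Z. f w = g}) \<in> I"
      using countable_eq_star_class fibre by (rule UN_in)
    moreover have "{w \<in> T. (z, w) \<in> B} \<subseteq> {w \<in> Z. (a w, a z) \<in> r} \<union>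
        (\<Union>g\<in>{g. g \<le>* f z \<and> f z \<le>* g}. {w \<in> Z. f w = g})"
    proof
      fix w assume "w \<in> {w \<in> T. (z, w) \<in> B}"
      then have w: "w \<in> Z" "z \<in> Z" "f w \<le>* f z" using B(2)[of z w] T(1) z by auto
      show "w \<in> {w \<in> Z. (a w, a z) \<in> r} \<union> (\<Union>g\<in>{g. g \<le>* f z \<and> f z \<le>* g}. {w \<in> Z. f w = g})"
      proof (cases "(a w, a z) \<in> r")
        case False
        then have "(a z, a w) \<in> r" "a z \<noteq> a w" using total a(1) w refl by metis+
        then have "f z \<le>* f w" using F a(2) w by simp
        then show ?thesis using w by blast
      qed (use w in blast)
    qed
    ultimately show "{w \<in> T. (z, w) \<in> B} \<in> I" using T(3)[OF z] Un_in subset_in by blast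
  next
    fix w assume w: "w \<in> T"
    have "{z \<in> T. (z, w) \<notin> B} \<subseteq> {z \<in> Z. (a z, a w) \<in> r}"
    proof clarify
      fix z assume z: "z \<in> T" "(z, w) \<notin> B"
      have "\<not> f w \<le>* f z" using B(2)[of z w] T(1) z w by blast
      then have "\<not> ((a w, a z) \<in> r \<and> a w \<noteq> a z)" using F a(2) T(1) z w by (metis subsetD)
      then show "z \<in> Z \<and> (a z, a w) \<in> r" using total refl a(1) T(1) z(1) w by (metis subsetD)
    qed
    then show "{z \<in> T. (z, w) \<notin> B} \<in> I" using T(3)[OF w] subset_in by blast
  qed
  then show False using T(2) by blast
qed

text \<open>Induction on \<open>J\<close>: on a fibre of one coordinate map the remaining maps are
  still jointly countable-to-one, so the fibre is small by induction and hypothesis \<open>X\<close>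
  applies to that coordinate.\<close>

lemma (in fubini_ideal) countable_to_one_in:
  fixes s :: "'j \<Rightarrow> real \<Rightarrow> real"
  assumes X: "\<And>Z s. s \<in> borel_measurable (restrict_space borel Z) \<Longrightarrow> s ` Z \<subseteq> X \<Longrightarrow>
      (\<And>x. {z \<in> Z. s z = x} \<in> I) \<Longrightarrow> Z \<in> I"
    and "finite J" and "\<And>j. j \<in> J \<Longrightarrow> s j \<in> borel_measurable (restrict_space borel Z)"
    and "\<And>j. j \<in> J \<Longrightarrow> s j ` Z \<subseteq> X"
    and "\<And>c. countable {z \<in> Z. \<forall>j\<in>J. s j z = c j}"
  shows "Z \<in> I"
  using assms(2-)
proof (induction J arbitrary: Z rule: finite_induct)
  case empty
  then show ?case using countable_in by simp
next
  case (insert i J)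
  show ?case
  proof (rule X)
    show "s i \<in> borel_measurable (restrict_space borel Z)" "s i ` Z \<subseteq> X"
      using insert.prems by blast+
    fix x
    show "{z \<in> Z. s i z = x} \<in> I"
    proof (rule insert.IH)
      fix j assume j: "j \<in> J"
      show "s j \<in> borel_measurable (restrict_space borel {z \<in> Z. s i z = x})"
        by (rule measurable_restrict_mono[OF insert.prems(1)]) (use j in auto)
      show "s j ` {z \<in> Z. s i z = x} \<subseteq> X" using insert.prems(2)[of j] j by blast
    next
      fix c
      have "{z \<in> {z \<in> Z. s i z = x}. \<forall>j\<in>J. s j z = c j} \<subseteq> {z \<in> Z. \<forall>j\<in>insert i J. s j z = (c(i := x)) j}"
        using insert.hyps by auto
      then show "countable {z \<in> {z \<in> Z. s i z = x}. \<forall>j\<in>J. s j z = c j}"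
        using insert.prems(3)[of "c(i := x)"] countable_subset by blast
    qed
  qed
qed

text \<open>Exchanging the coordinates and passing to the complement turns one of the two section
  hypotheses of \<open>fubini\<close> into the other.\<close>

lemma sets_pair_swap_complement:
  fixes B :: "(real \<times> real) set"
  assumes "B \<in> sets (borel \<Otimes>\<^sub>M borel)"
  shows "{(w, z). (z, w) \<notin> B} \<in> sets (borel \<Otimes>\<^sub>M borel)"
proof -
  have "(\<lambda>(x, y). (y, x)) -` (space (borel \<Otimes>\<^sub>M borel) - B) \<inter> space (borel \<Otimes>\<^sub>M borel) \<in> sets (borel \<Otimes>\<^sub>M (borel :: real measure))"
    using assms by (intro measurable_sets[OF measurable_pair_swap']) auto
  moreover have "(\<lambda>(x, y). (y, x)) -` (space (borel \<Otimes>\<^sub>M borel) - B) \<inter> space (borel \<Otimes>\<^sub>M borel) = {(w, z). (z, w) \<notin> B}"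
    by (auto simp: space_pair_measure)
  ultimately show ?thesis by simp
qed

section \<open>Lebesgue null sets\<close>

lemma sets_lborel_pair: "sets (lborel \<Otimes>\<^sub>M lborel) = sets (borel \<Otimes>\<^sub>M (borel :: real measure))"
  by (intro sets_pair_measure_cong sets_lborel)

text \<open>A Borel set that meets \<open>Z\<close> in a null set also meets the envelope
  \<open>H\<close> in a null set. This is used twice: in the second coordinate for each single
  section over a point of \<open>Z\<close>, and in the first coordinate for the set of points whose
  section is not null.\<close>

lemma null_sections_imp_null:
  fixes Z H :: "real set"
  assumes H: "measurable_envelope lborel Z H" and B: "B \<in> sets (borel \<Otimes>\<^sub>M borel)"
    and null: "\<And>z. z \<in> Z \<Longrightarrow> {w \<in> Z. (z, w) \<in> B} \<in> null_sets lebesgue"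
  shows "emeasure (lborel \<Otimes>\<^sub>M lborel) (B \<inter> H \<times> H) = 0"
proof -
  note [simp] = measurable_envelopeD(2)[OF H, simplified]
  have Bl: "B \<in> sets (lborel \<Otimes>\<^sub>M lborel)"
    unfolding sets_lborel_pair by (rule B)
  have Hl: "H \<in> sets lborel" by simp
  have D[measurable]: "B \<inter> H \<times> H \<in> sets (lborel \<Otimes>\<^sub>M lborel)"
    by (rule sets.Int[OF Bl pair_measureI[OF Hl Hl]])
  have outer: "emeasure lborel (F \<inter> H) = 0" if F: "F \<in> sets borel" "F \<inter> Z \<in> null_sets lebesgue" for F
  proof -
    obtain N where N: "N \<in> null_sets lborel" "F \<inter> Z \<subseteq> N"
      using F(2) unfolding null_sets_completion_iff2 by (elim bexE)
    have "emeasure lborel (F \<inter> H) = outer_measure_of lborel (F \<inter> Z)"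
      using measurable_envelopeD(3)[OF H] F(1) by simp
    also have "\<dots> \<le> outer_measure_of lborel N" using N(2) by (rule outer_measure_of_mono)
    also have "\<dots> = 0" using outer_measure_of_eq[OF null_setsD2[OF N(1)]] null_setsD1[OF N(1)] by simp
    finally show ?thesis by simp
  qed
  have sec: "Pair z -` B \<in> sets borel" for z using sets_Pair1[OF B] .
  \<comment> \<open>A Borel set that will turn out to miss \<open>Z\<close>, so it is null inside
    \<open>H\<close>; over points outside \<open>H\<close> the sections are empty.\<close>
  let ?G = "{z \<in> space lborel. emeasure lborel (Pair z -` (B \<inter> H \<times> H)) \<noteq> 0}"
  have G: "?G \<in> sets borel"
  proof -
    have "(\<lambda>z. emeasure lborel (Pair z -` (B \<inter> H \<times> H))) \<in> borel_measurable lborel"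
      using D by (rule lborel.measurable_emeasure_Pair)
    then have "?G \<in> sets lborel" by measurable
    then show ?thesis by simp
  qed
  have GZ: "?G \<inter> Z = {}"
  proof -
    have "emeasure lborel (Pair z -` (B \<inter> H \<times> H)) = 0" if "z \<in> Z" for z
    proof -
      have "z \<in> H" using that measurable_envelopeD(1)[OF H] by blast
      then have "Pair z -` (B \<inter> H \<times> H) = Pair z -` B \<inter> H" by auto
      moreover have "Pair z -` B \<inter> Z \<in> null_sets lebesgue"
      proof -
        have "Pair z -` B \<inter> Z = {w \<in> Z. (z, w) \<in> B}" by auto
        then show ?thesis using null[OF that] by simp
      qed
      ultimately show ?thesis using outer[OF sec[of z]] by simp
    qed
    then show ?thesis by blast
  qed
  then have "emeasure lborel (?G \<inter> H) = 0" using outer[OF G] by simp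
  moreover have "?G \<subseteq> H"
  proof -
    have "Pair z -` (B \<inter> H \<times> H) = {}" if "z \<notin> H" for z using that by auto
    then show ?thesis by fastforce
  qed
  ultimately have G0: "emeasure lborel ?G = 0" by (simp add: Int_absorb2)
  have "AE z in lborel. emeasure lborel (Pair z -` (B \<inter> H \<times> H)) = 0"
    using G G0 by (intro AE_I[of _ _ ?G]) auto
  then have "(\<integral>\<^sup>+z. emeasure lborel (Pair z -` (B \<inter> H \<times> H)) \<partial>lborel) = 0"
    by (subst nn_integral_0_iff_AE[OF lborel.measurable_emeasure_Pair[OF D]])
  then show ?thesis using lborel.emeasure_pair_measure_alt[OF D] by simp
qed

lemma fubini_ideal_null: "fubini_ideal (null_sets lebesgue)"
proof
  show "A \<in> null_sets lebesgue" if "countable A" for A :: "real set"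
    using countable_imp_null_set_lborel[OF that] null_sets_completionI by blast
  show "B \<in> null_sets lebesgue" if "A \<in> null_sets lebesgue" "B \<subseteq> A" for A B :: "real set"
    using that null_sets_completion_subset by blast
  show "\<Union>\<A> \<in> null_sets lebesgue" if "countable \<A>" "\<A> \<subseteq> null_sets lebesgue" for \<A> :: "real set set"
    using that null_sets_UN'[of \<A> "\<lambda>A. A" lebesgue] by auto
  fix B :: "(real \<times> real) set" and Z
  assume B: "B \<in> sets (borel \<Otimes>\<^sub>M borel)"
    and 1: "\<And>z. z \<in> Z \<Longrightarrow> {w \<in> Z. (z, w) \<in> B} \<in> null_sets lebesgue"
    and 2: "\<And>w. w \<in> Z \<Longrightarrow> {z \<in> Z. (z, w) \<notin> B} \<in> null_sets lebesgue"
  \<comment> \<open>On a bounded interval the outer measure is finite, and then a Borel superset of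
    the same outer measure is an envelope.\<close>
  have bounded: "Z \<inter> {-real n..real n} \<in> null_sets lebesgue" for n
  proof -
    let ?Z = "Z \<inter> {-real n..real n}"
    obtain E where E: "E \<in> sets lborel" "?Z \<subseteq> E" "outer_measure_of lborel ?Z = emeasure lborel E"
      using outer_measure_of_attain[of ?Z lborel] by auto
    have "emeasure lborel E \<le> emeasure lborel {-real n..real n}"
      unfolding E(3)[symmetric] outer_measure_of_def by (intro INF_lower) auto
    then have fin: "emeasure lborel E < \<infinity>" by (simp add: order_le_less_trans)
    have env: "measurable_envelope lborel ?Z E"
      using measurable_envelope_eq2[OF E(2,1) fin] E(3) by simp
    have B': "{(w, z). (z, w) \<notin> B} \<in> sets (borel \<Otimes>\<^sub>M borel)"
      using B by (rule sets_pair_swap_complement)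
    have mono: "A \<in> null_sets lebesgue" if "A' \<in> null_sets lebesgue" "A \<subseteq> A'" for A A' :: "real set"
      using that null_sets_completion_subset by blast
    have e1: "emeasure (lborel \<Otimes>\<^sub>M lborel) (B \<inter> E \<times> E) = 0"
      by (rule null_sections_imp_null[OF env B]) (auto intro: mono[OF 1])
    have e2: "emeasure (lborel \<Otimes>\<^sub>M lborel) ({(w, z). (z, w) \<notin> B} \<inter> E \<times> E) = 0"
      by (rule null_sections_imp_null[OF env B']) (auto intro: mono[OF 2])
    have S: "B \<in> sets (lborel \<Otimes>\<^sub>M lborel)" "{(w, z). (z, w) \<notin> B} \<in> sets (lborel \<Otimes>\<^sub>M lborel)" "E \<times> E \<in> sets (lborel \<Otimes>\<^sub>M lborel)"
      using B B' E(1) by (simp_all only: sets_lborel_pair pair_measureI sets_lborel)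
    \<comment> \<open>The mirror image of \<open>B\<close> within \<open>E \<times> E\<close> is
      exactly what the reflected complement of \<open>B\<close> leaves uncovered, so
      \<open>E \<times> E\<close> is a union of two null sets.\<close>
    have sw: "(\<lambda>(x, y). (y, x)) -` (B \<inter> E \<times> E) \<inter> space (lborel \<Otimes>\<^sub>M lborel) = (E \<times> E) - {(w, z). (z, w) \<notin> B}"
      by (auto simp: space_pair_measure)
    have "emeasure (lborel \<Otimes>\<^sub>M lborel) ((E \<times> E) - {(w, z). (z, w) \<notin> B}) = emeasure (distr (lborel \<Otimes>\<^sub>M lborel) (lborel \<Otimes>\<^sub>M lborel) (\<lambda>(x, y). (y, x))) (B \<inter> E \<times> E)"
      unfolding sw[symmetric] using S by (intro emeasure_distr[symmetric] measurable_pair_swap') auto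
    also have "\<dots> = 0" using e1 by (subst lborel_pair.distr_pair_swap[symmetric])
    finally have e3: "emeasure (lborel \<Otimes>\<^sub>M lborel) ((E \<times> E) - {(w, z). (z, w) \<notin> B}) = 0" .
    have "emeasure (lborel \<Otimes>\<^sub>M lborel) (E \<times> E) \<le> emeasure (lborel \<Otimes>\<^sub>M lborel)
        ({(w, z). (z, w) \<notin> B} \<inter> E \<times> E \<union> ((E \<times> E) - {(w, z). (z, w) \<notin> B}))"
      using S by (intro emeasure_mono) auto
    also have "\<dots> \<le> 0"
      using S by (intro order_trans[OF emeasure_subadditive]) (auto simp: e2 e3)
    finally have "emeasure (lborel \<Otimes>\<^sub>M lborel) (E \<times> E) = 0" by simp
    then have "emeasure lborel E = 0" using E(1) lborel.emeasure_pair_measure_Times[of E lborel E] by simp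
    then have "E \<in> null_sets lborel" using E(1) by auto
    then show ?thesis using E(2) mono null_sets_completionI by blast
  qed
  have "Z = (\<Union>n. Z \<inter> {-real n..real n})"
  proof -
    have "\<exists>n. z \<in> {-real n..real n}" for z :: real
    proof -
      obtain n where "\<bar>z\<bar> \<le> real n" using real_arch_simple by blast
      then show ?thesis by (intro exI[of _ n]) (auto simp: abs_le_iff)
    qed
    then show ?thesis by blast
  qed
  then show "Z \<in> null_sets lebesgue" using null_sets_UN[of "\<lambda>n. Z \<inter> {-real n..real n}" lebesgue] bounded by auto
qed

section \<open>Meager sets\<close>

lemma meager_subset: "meager A \<Longrightarrow> B \<subseteq> A \<Longrightarrow> meager B"
  unfolding meager_def by (meson subset_trans)

lemma meager_Union:
  assumes "countable \<A>" "\<And>A. A \<in> \<A> \<Longrightarrow> meager A"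
  shows "meager (\<Union>\<A>)"
proof -
  have "\<forall>A\<in>\<A>. \<exists>\<N>. countable \<N> \<and> (\<forall>N\<in>\<N>. interior (closure N) = {}) \<and> A \<subseteq> \<Union>\<N>"
    using assms(2) unfolding meager_def by simp
  from bchoice[OF this] obtain \<N> where
    \<N>: "\<forall>A\<in>\<A>. countable (\<N> A) \<and> (\<forall>N\<in>\<N> A. interior (closure N) = {}) \<and> A \<subseteq> \<Union>(\<N> A)" ..
  show ?thesis
    unfolding meager_def
  proof (intro exI[of _ "\<Union>A\<in>\<A>. \<N> A"] conjI)
    show "countable (\<Union>A\<in>\<A>. \<N> A)" using assms(1) \<N> by auto
    show "\<forall>N\<in>\<Union>A\<in>\<A>. \<N> A. interior (closure N) = {}" using \<N> by blast
    show "\<Union>\<A> \<subseteq> \<Union>(\<Union>A\<in>\<A>. \<N> A)"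
    proof
      fix x assume "x \<in> \<Union>\<A>"
      then obtain A where A: "A \<in> \<A>" "x \<in> A" by blast
      have "A \<subseteq> \<Union>(\<N> A)" using \<N> A(1) by simp
      then have "x \<in> \<Union>(\<N> A)" using A(2) by blast
      then show "x \<in> \<Union>(\<Union>A\<in>\<A>. \<N> A)" using A(1) by blast
    qed
  qed
qed

lemma meager_UN: "countable K \<Longrightarrow> (\<And>k. k \<in> K \<Longrightarrow> meager (A k)) \<Longrightarrow> meager (\<Union>k\<in>K. A k)"
  using meager_Union[of "A ` K"] by auto

lemma meager_Un: "meager A \<Longrightarrow> meager B \<Longrightarrow> meager (A \<union> B)"
  using meager_Union[of "{A, B}"] by auto

lemma meager_nowhere_dense: "interior (closure N) = {} \<Longrightarrow> meager N"
  unfolding meager_def by (intro exI[of _ "{N}"]) auto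

lemma meager_countable:
  fixes A :: "'a::{t1_space, perfect_space} set"
  assumes "countable A"
  shows "meager A"
proof -
  have "interior (closure {x}) = {}" for x :: 'a
    by (simp add: interior_singleton)
  then have "meager (\<Union>x\<in>A. {x})"
    using assms by (intro meager_UN meager_nowhere_dense) auto
  then show ?thesis by simp
qed

lemma open_not_meager:
  fixes U :: "'a::{real_normed_vector, heine_borel} set"
  assumes "open U" "U \<noteq> {}"
  shows "\<not> meager U"
proof
  assume "meager U"
  then obtain \<N> where \<N>: "countable \<N>" "\<And>N. N \<in> \<N> \<Longrightarrow> interior (closure N) = {}" "U \<subseteq> \<Union>\<N>"
    unfolding meager_def by blast
  have "UNIV \<subseteq> closure (\<Inter>((\<lambda>N. - closure N) ` \<N>))"
  proof (rule Baire)
    fix T assume "T \<in> (\<lambda>N. - closure N) ` \<N>"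
    then obtain N where "N \<in> \<N>" "T = - closure N" by blast
    then show "openin (top_of_set UNIV) T \<and> UNIV \<subseteq> closure T"
      using \<N>(2)[of N] by (simp add: closure_complement open_Compl)
  qed (use \<N>(1) in auto)
  then have "U \<inter> \<Inter>((\<lambda>N. - closure N) ` \<N>) \<noteq> {}"
    using assms open_Int_closure_eq_empty[OF assms(1)] by blast
  then obtain x where "x \<in> U" "\<And>N. N \<in> \<N> \<Longrightarrow> x \<notin> closure N" by blast
  then show False using \<N>(3) closure_subset by blast
qed

lemma meager_swap:
  fixes A :: "('a::euclidean_space \<times> 'a) set"
  assumes "meager A"
  shows "meager (prod.swap ` A)"
proof -
  obtain \<N> where \<N>: "countable \<N>" "\<And>N. N \<in> \<N> \<Longrightarrow> interior (closure N) = {}" "A \<subseteq> \<Union>\<N>"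
    using assms unfolding meager_def by blast
  have lin: "linear (prod.swap :: 'a \<times> 'a \<Rightarrow> _)" by (auto simp: linear_iff)
  have "interior (closure (prod.swap ` N)) = {}" if "N \<in> \<N>" for N
  proof -
    have "closure (prod.swap ` N) = prod.swap ` closure N"
      using closure_injective_linear_image[OF lin] inj_swap by metis
    also have "interior (prod.swap ` closure N) = prod.swap ` interior (closure N)"
      using lin by (intro interior_bijective_linear_image) (simp_all add: bij_swap)
    finally show ?thesis using \<N>(2)[OF that] by simp
  qed
  then show ?thesis
    unfolding meager_def
  proof (intro exI[of _ "(`) prod.swap ` \<N>"] conjI)
    show "countable ((`) prod.swap ` \<N>)" using \<N>(1) by simp
    show "prod.swap ` A \<subseteq> \<Union>((`) prod.swap ` \<N>)" using \<N>(3) by blast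
  qed blast
qed

text \<open>If a section of \<open>closure N\<close> has interior, it contains a nonempty basic open
  \<open>V\<close>, which places the base point in \<open>E N V\<close>. That set is closed, and an
  open set inside it would yield an open rectangle inside \<open>closure N\<close>.\<close>

lemma kuratowski_ulam_meager:
  fixes M :: "('a::topological_space \<times> 'b::second_countable_topology) set"
  assumes "meager M"
  shows "meager {z. \<not> meager {w. (z, w) \<in> M}}"
proof -
  obtain \<B> :: "'b set set" where \<B>: "countable \<B>" "topological_basis \<B>"
    using ex_countable_basis by blast
  obtain \<N> where \<N>: "countable \<N>" "\<And>N. N \<in> \<N> \<Longrightarrow> interior (closure N) = {}" "M \<subseteq> \<Union>\<N>"
    using assms unfolding meager_def by blast
  define E where "E N V = {z. \<forall>w\<in>V. (z, w) \<in> closure N}" for N :: "('a \<times> 'b) set" and V :: "'b set"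
  have E: "meager (E N V)" if N: "N \<in> \<N>" and V: "V \<in> \<B>" "V \<noteq> {}" for N V
  proof (rule meager_nowhere_dense)
    have "E N V = (\<Inter>w\<in>V. (\<lambda>z. (z, w)) -` closure N)" by (auto simp: E_def)
    moreover have "closed ((\<lambda>z. (z, w)) -` closure N)" for w
      by (intro closed_vimage closed_closure continuous_intros)
    ultimately have "closed (E N V)" by auto
    then have "interior (closure (E N V)) = interior (E N V)" by simp
    also have "\<dots> \<times> V \<subseteq> interior (closure N)"
    proof (rule interior_maximal)
      show "interior (E N V) \<times> V \<subseteq> closure N" using interior_subset by (fastforce simp: E_def)
      show "open (interior (E N V) \<times> V)"
        using V(1) \<B>(2) by (intro open_Times) (auto simp: topological_basis_open)
    qed
    finally show "interior (closure (E N V)) = {}" using \<N>(2)[OF N] V(2) by blast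
  qed
  have "{z. \<not> meager {w. (z, w) \<in> M}} \<subseteq> (\<Union>N\<in>\<N>. \<Union>V\<in>\<B> - {{}}. E N V)"
  proof (rule subsetI, rule ccontr)
    fix z assume z: "z \<in> {z. \<not> meager {w. (z, w) \<in> M}}" "z \<notin> (\<Union>N\<in>\<N>. \<Union>V\<in>\<B> - {{}}. E N V)"
    have "meager {w. (z, w) \<in> closure N}" if N: "N \<in> \<N>" for N
    proof (rule meager_nowhere_dense)
      have "closed {w. (z, w) \<in> closure N}"
        using closed_vimage[OF closed_closure, of "\<lambda>w. (z, w)" N]
        by (simp add: vimage_def continuous_on_Pair)
      moreover have "interior {w. (z, w) \<in> closure N} = {}"
      proof (rule ccontr)
        assume "interior {w. (z, w) \<in> closure N} \<noteq> {}"
        then obtain w where "w \<in> interior {w. (z, w) \<in> closure N}" by blast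
        then obtain V where V: "V \<in> \<B>" "w \<in> V" "V \<subseteq> interior {w. (z, w) \<in> closure N}"
          using topological_basisE[OF \<B>(2) open_interior] by metis
        then have "z \<in> E N V" using interior_subset unfolding E_def by fastforce
        then show False using z(2) N V by blast
      qed
      ultimately show "interior (closure {w. (z, w) \<in> closure N}) = {}" by simp
    qed
    then have "meager (\<Union>N\<in>\<N>. {w. (z, w) \<in> closure N})" using \<N>(1) by (intro meager_UN)
    then have "meager {w. (z, w) \<in> M}"
      by (rule meager_subset) (use \<N>(3) closure_subset in blast)
    then show False using z(1) by simp
  qed
  moreover have "meager (\<Union>N\<in>\<N>. \<Union>V\<in>\<B> - {{}}. E N V)"
    using \<N>(1) \<B>(1) E by (intro meager_UN) auto
  ultimately show ?thesis by (rule meager_subset[rotated])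
qed

text \<open>The sets that equal an open set up to a meager set form a sigma-algebra. For a
  complement the open set is the interior of \<open>- U\<close>, which differs from
  \<open>- U\<close> by a closed set without interior.\<close>

lemma borel_baire_property:
  assumes "B \<in> sets borel"
  shows "\<exists>U. open U \<and> meager ((B - U) \<union> (U - B))"
proof -
  have "B \<in> sigma_sets UNIV {S. open S}" using assms by (simp add: borel_def)
  then show ?thesis
  proof (induction rule: sigma_sets.induct)
    case (Basic a)
    then show ?case by (intro exI[of _ a]) (auto intro: meager_countable meager_nowhere_dense)
  next
    case Empty
    then show ?case by (intro exI[of _ "{}"]) (auto intro: meager_nowhere_dense)
  next
    case (Compl a)
    then obtain U where U: "open U" "meager ((a - U) \<union> (U - a))" by blast
    have "closed (- U - interior (- U))" using U(1) by (auto intro: closed_Diff)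
    moreover have "interior (- U - interior (- U)) = {}"
    proof -
      have "interior (- U - interior (- U)) \<subseteq> interior (- U)" by (intro interior_mono) auto
      moreover have "interior (- U - interior (- U)) \<subseteq> - interior (- U)" using interior_subset by fastforce
      ultimately show ?thesis by blast
    qed
    ultimately have "meager (- U - interior (- U))" by (intro meager_nowhere_dense) simp
    then have "meager ((- U - interior (- U)) \<union> ((a - U) \<union> (U - a)))" using U(2) meager_Un by blast
    moreover have "(UNIV - a - interior (- U)) \<union> (interior (- U) - (UNIV - a)) \<subseteq>
        (- U - interior (- U)) \<union> ((a - U) \<union> (U - a))"
      using interior_subset[of "- U"] by blast
    ultimately show ?case using meager_subset by (intro exI[of _ "interior (- U)"]) blast
  next
    case (Union a)
    then have "\<forall>i. \<exists>U. open U \<and> meager ((a i - U) \<union> (U - a i))" by blast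
    then obtain U where U: "\<And>i. open (U i)" "\<And>i. meager ((a i - U i) \<union> (U i - a i))" by metis
    have "meager (\<Union>i. (a i - U i) \<union> (U i - a i))" using U(2) by (intro meager_UN) auto
    moreover have "(\<Union>i. a i) - (\<Union>i. U i) \<union> ((\<Union>i. U i) - (\<Union>i. a i)) \<subseteq> (\<Union>i. (a i - U i) \<union> (U i - a i))"
      by blast
    ultimately show ?case using U(1) meager_subset by (intro exI[of _ "\<Union>i. U i"]) blast
  qed
qed

text \<open>The category counterpart of a measurable envelope. By second countability
  \<open>Z\<close> is meager in the union \<open>W\<close> of all basic open sets in which it is
  meager; if no \<open>J\<close> existed, \<open>W\<close> would be dense and its complement nowhere
  dense.\<close>

lemma everywhere_nonmeager:
  fixes Z :: "'a::second_countable_topology set"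
  assumes "\<not> meager Z"
  shows "\<exists>J. open J \<and> J \<noteq> {} \<and> (\<forall>V. open V \<longrightarrow> V \<noteq> {} \<longrightarrow> V \<subseteq> J \<longrightarrow> \<not> meager (Z \<inter> V))"
proof (rule ccontr)
  assume neg: "\<nexists>J. open J \<and> J \<noteq> {} \<and> (\<forall>V. open V \<longrightarrow> V \<noteq> {} \<longrightarrow> V \<subseteq> J \<longrightarrow> \<not> meager (Z \<inter> V))"
  obtain \<B> :: "'a set set" where \<B>: "countable \<B>" "topological_basis \<B>"
    using ex_countable_basis by blast
  define W where "W = \<Union>{V \<in> \<B>. meager (Z \<inter> V)}"
  have W: "open W" using \<B>(2) unfolding W_def by (auto simp: topological_basis_open)
  have "meager (\<Union>V\<in>{V \<in> \<B>. meager (Z \<inter> V)}. Z \<inter> V)" using \<B>(1) by (intro meager_UN) auto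
  then have 1: "meager (Z \<inter> W)" by (rule meager_subset) (auto simp: W_def)
  have "interior (- W) = {}"
  proof (rule ccontr)
    assume "interior (- W) \<noteq> {}"
    moreover have "open (interior (- W))" by simp
    ultimately obtain V where V: "open V" "V \<noteq> {}" "V \<subseteq> interior (- W)" "meager (Z \<inter> V)"
      using neg by blast
    then obtain x where "x \<in> V" by blast
    then obtain V' where V': "V' \<in> \<B>" "x \<in> V'" "V' \<subseteq> V"
      using topological_basisE[OF \<B>(2) V(1)] by metis
    have "meager (Z \<inter> V')" using V(4) by (rule meager_subset) (use V'(3) in blast)
    then have "x \<in> W" using V' unfolding W_def by blast
    then show False using \<open>x \<in> V\<close> V(3) interior_subset by blast
  qed
  then have "meager (- W)" using W by (intro meager_nowhere_dense) (simp add: closed_Compl)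
  then have "meager ((Z \<inter> W) \<union> - W)" by (rule meager_Un[OF 1])
  then have "meager Z" by (rule meager_subset) blast
  then show False using assms by blast
qed

text \<open>The counterpart of \<open>null_sections_imp_null\<close>, with \<open>J\<close> as the
  envelope. Up to a meager error \<open>B\<close> is an open set \<open>U\<close>. A rectangle
  \<open>A \<times> A'\<close> inside both \<open>U\<close> and \<open>J \<times> J\<close> is
  impossible: by Kuratowski-Ulam some point of \<open>Z \<inter> A\<close> has a meager section of
  the error, which would make \<open>Z \<inter> A'\<close> meager.\<close>

lemma meager_sections_imp_meager:
  fixes Z J :: "real set"
  assumes J: "open J" "\<And>V. open V \<Longrightarrow> V \<noteq> {} \<Longrightarrow> V \<subseteq> J \<Longrightarrow> \<not> meager (Z \<inter> V)"
    and B: "B \<in> sets (borel \<Otimes>\<^sub>M borel)"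
    and sec: "\<And>z. z \<in> Z \<Longrightarrow> meager {w \<in> Z. (z, w) \<in> B}"
  shows "meager (B \<inter> J \<times> J)"
proof -
  have "B \<in> sets borel" using B unfolding borel_prod .
  then obtain U where U: "open U" "meager ((B - U) \<union> (U - B))" using borel_baire_property by blast
  let ?M = "(B - U) \<union> (U - B)"
  have E: "meager {z. \<not> meager {w. (z, w) \<in> ?M}}" using U(2) by (rule kuratowski_ulam_meager)
  have "U \<inter> J \<times> J = {}"
  proof (rule ccontr)
    assume "U \<inter> J \<times> J \<noteq> {}"
    then obtain z0 w0 where zw: "(z0, w0) \<in> U \<inter> J \<times> J" by auto
    have "open (U \<inter> J \<times> J)" using U(1) J(1) by (intro open_Int open_Times)
    then obtain A A' where A: "open A" "open A'" "z0 \<in> A" "w0 \<in> A'" "A \<times> A' \<subseteq> U \<inter> J \<times> J"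
      using zw by (rule open_prod_elim) blast
    have "A \<subseteq> J" using A(4,5) by blast
    then have "\<not> meager (Z \<inter> A)" using J(2) A(1,3) by blast
    then obtain z where z: "z \<in> Z" "z \<in> A" "meager {w. (z, w) \<in> ?M}"
      using meager_subset[OF E, of "Z \<inter> A"] by blast
    have "meager ({w \<in> Z. (z, w) \<in> B} \<union> {w. (z, w) \<in> ?M})" using sec[OF z(1)] z(3) by (rule meager_Un)
    then have "meager (Z \<inter> A')" by (rule meager_subset) (use A(5) z(2) in blast)
    moreover have "A' \<subseteq> J" using A(3,5) by blast
    ultimately show False using J(2)[OF A(2)] A(4) by blast
  qed
  then have "B \<inter> J \<times> J \<subseteq> ?M" by blast
  then show ?thesis by (rule meager_subset[OF U(2)])
qed

lemma fubini_ideal_meager: "fubini_ideal {A. meager A}"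
proof
  fix B :: "(real \<times> real) set" and Z
  assume B: "B \<in> sets (borel \<Otimes>\<^sub>M borel)"
    and 1: "\<And>z. z \<in> Z \<Longrightarrow> {w \<in> Z. (z, w) \<in> B} \<in> {A. meager A}"
    and 2: "\<And>w. w \<in> Z \<Longrightarrow> {z \<in> Z. (z, w) \<notin> B} \<in> {A. meager A}"
  have "meager Z"
  proof (rule ccontr)
    assume "\<not> meager Z"
    from everywhere_nonmeager[OF this] obtain J
      where "open J \<and> J \<noteq> {} \<and> (\<forall>V. open V \<longrightarrow> V \<noteq> {} \<longrightarrow> V \<subseteq> J \<longrightarrow> \<not> meager (Z \<inter> V))" ..
    then have J: "open J" "J \<noteq> {}" "\<And>V. open V \<Longrightarrow> V \<noteq> {} \<Longrightarrow> V \<subseteq> J \<Longrightarrow> \<not> meager (Z \<inter> V)"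
      by simp_all
    have B': "{(w, z). (z, w) \<notin> B} \<in> sets (borel \<Otimes>\<^sub>M borel)"
      using B by (rule sets_pair_swap_complement)
    have "meager (B \<inter> J \<times> J)"
      using J(1,3) B 1 by (intro meager_sections_imp_meager[of J Z]) auto
    moreover have "meager ({(w, z). (z, w) \<notin> B} \<inter> J \<times> J)"
      using J(1,3) B' 2 by (intro meager_sections_imp_meager[of J Z]) auto
    ultimately have "meager ((B \<inter> J \<times> J) \<union> prod.swap ` ({(w, z). (z, w) \<notin> B} \<inter> J \<times> J))"
      using meager_Un meager_swap by blast
    then have "meager (J \<times> J)" by (rule meager_subset) force
    then show False using open_not_meager[of "J \<times> J"] J(1,2) by (auto simp: open_Times)
  qed
  then show "Z \<in> {A. meager A}" by simp
next
  show "A \<in> {A. meager A}" if "countable A" for A :: "real set"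
    using meager_countable[OF that] by simp
  show "B \<in> {A. meager A}" if "A \<in> {A. meager A}" "B \<subseteq> A" for A B :: "real set"
    using meager_subset that by simp
  show "\<Union>\<A> \<in> {A. meager A}" if "countable \<A>" "\<A> \<subseteq> {A. meager A}" for \<A> :: "real set set"
    using meager_Union[OF that(1)] that(2) by blast
qed

text \<open>Over the scale part, \<open>h'\<close> turns \<open>s\<close> into a sequence-valued map
  whose coordinates have level sets given by closed subsets of \<open>C\<close>, so
  \<open>scale_valued_in\<close> applies. The rest of \<open>Z\<close> consists of countably many
  fibres, one for each point of \<open>increasing_enat_inf\<close>.\<close>

lemma (in fubini_ideal) scale_set_in:
  fixes C :: "real set"
  assumes S: "b_scale S" and h: "homeomorphism increasing_enat C h h'" and C: "compact C"
    and s: "s \<in> borel_measurable (restrict_space borel Z)"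
    and sX: "s ` Z \<subseteq> h ` ((\<lambda>f. enat \<circ> f) ` S \<union> increasing_enat_inf)"
    and fibre: "\<And>x. {z \<in> Z. s z = x} \<in> I"
  shows "Z \<in> I"
proof -
  have SM: "\<And>f. f \<in> S \<Longrightarrow> strict_mono f"
    using S by (simp add: b_scale_def)
  have "\<exists>F. S = F ` Field bounding_number \<and>
      (\<forall>\<alpha> \<beta>. (\<alpha>, \<beta>) \<in> bounding_number \<and> \<alpha> \<noteq> \<beta> \<longrightarrow> F \<alpha> \<le>* F \<beta>)"
    using S by (simp add: b_scale_def)
  then obtain F where F: "S = F ` Field bounding_number \<and>
      (\<forall>\<alpha> \<beta>. (\<alpha>, \<beta>) \<in> bounding_number \<and> \<alpha> \<noteq> \<beta> \<longrightarrow> F \<alpha> \<le>* F \<beta>)" ..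
  have Si: "(\<lambda>f. enat \<circ> f) ` S \<subseteq> increasing_enat" using SM strict_mono_in_increasing_enat by blast
  have h'h: "h' (h x) = x" if "x \<in> increasing_enat" for x
    using h that unfolding homeomorphism_def by blast
  define Z' where "Z' = {z \<in> Z. s z \<in> h ` (\<lambda>f. enat \<circ> f) ` S}"
  define f where "f z n = the_enat (h' (s z) n)" for z n
  have f: "f z \<in> S" "s z = h (enat \<circ> f z)" "h' (s z) = enat \<circ> f z" if hz: "z \<in> Z'" for z
  proof -
    obtain g where g: "g \<in> S" "s z = h (enat \<circ> g)" using hz by (auto simp: Z'_def)
    moreover have "h' (s z) = enat \<circ> g" using h'h g Si by auto
    ultimately show "f z \<in> S" "s z = h (enat \<circ> f z)" "h' (s z) = enat \<circ> f z"
      by (simp_all add: f_def[abs_def])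
  qed
  have "Z' \<in> I"
  proof (rule scale_valued_in)
    show "Well_order bounding_number"
      using Card_order_bounding_number by (simp add: card_order_on_def)
    show "F \<alpha> \<le>* F \<beta>" if "(\<alpha>, \<beta>) \<in> bounding_number" "\<alpha> \<noteq> \<beta>" for \<alpha> \<beta> using F that by blast
    show "f ` Z' \<subseteq> F ` Field bounding_number" using f(1) F by blast
    fix n
    have s': "s \<in> borel_measurable (restrict_space borel Z')"
      by (rule measurable_restrict_mono[OF s]) (auto simp: Z'_def)
    have "(\<lambda>z. f z n) -` {k} \<inter> space (restrict_space borel Z') \<in> sets (restrict_space borel Z')" for k
    proof -
      have "continuous_on C (\<lambda>x. h' x n)"
        by (rule continuous_on_product_then_coordinatewise) (use h in \<open>simp add: homeomorphism_def\<close>)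
      then have "closedin (top_of_set C) (C \<inter> (\<lambda>x. h' x n) -` {enat k})"
        by (intro continuous_closedin_preimage) auto
      then have "closed (C \<inter> (\<lambda>x. h' x n) -` {enat k})"
        using compact_imp_closed[OF C] by (rule closedin_closed_trans)
      then have "s -` (C \<inter> (\<lambda>x. h' x n) -` {enat k}) \<inter> space (restrict_space borel Z') \<in> sets (restrict_space borel Z')"
        by (rule measurable_sets[OF s' borel_closed])
      moreover have "s -` (C \<inter> (\<lambda>x. h' x n) -` {enat k}) \<inter> space (restrict_space borel Z') =
          (\<lambda>z. f z n) -` {k} \<inter> space (restrict_space borel Z')"
      proof -
        have "s z \<in> C \<and> h' (s z) n = enat k \<longleftrightarrow> f z n = k" if "z \<in> Z'" for z
        proof -
          have "enat \<circ> f z \<in> increasing_enat" using f(1)[OF that] Si by blast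
          then have "s z \<in> C" using h unfolding f(2)[OF that] homeomorphism_def by blast
          then show ?thesis using f(3)[OF that] by simp
        qed
        then show ?thesis by (auto simp: space_restrict_space)
      qed
      ultimately show ?thesis by simp
    qed
    then show "(\<lambda>z. f z n) \<in> measurable (restrict_space borel Z') (count_space UNIV)"
      by (simp add: measurable_count_space_eq2_countable)
    fix g
    have "{z \<in> Z'. f z = g} \<subseteq> {z \<in> Z. s z = h (enat \<circ> g)}"
      using f(2) by (auto simp: Z'_def)
    then show "{z \<in> Z'. f z = g} \<in> I" using fibre subset_in by blast
  qed
  moreover have "(\<Union>q\<in>increasing_enat_inf. {z \<in> Z. s z = h q}) \<in> I"
    using countable_increasing_enat_inf fibre by (rule UN_in)
  ultimately have "Z' \<union> (\<Union>q\<in>increasing_enat_inf. {z \<in> Z. s z = h q}) \<in> I" by (rule Un_in)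
  moreover have "Z \<subseteq> Z' \<union> (\<Union>q\<in>increasing_enat_inf. {z \<in> Z. s z = h q})"
  proof
    fix z assume z: "z \<in> Z"
    then have "s z \<in> h ` ((\<lambda>f. enat \<circ> f) ` S \<union> increasing_enat_inf)" using sX by blast
    then show "z \<in> Z' \<union> (\<Union>q\<in>increasing_enat_inf. {z \<in> Z. s z = h q})"
      using z unfolding Z'_def image_Un by blast
  qed
  ultimately show ?thesis by (rule subset_in)
qed

section \<open>Fields generated by algebraically independent reals\<close>

text \<open>The type of variables is left open: over natural numbers there are only countably many
  expressions, over the reals a variable can name its own value, and \<open>map_pexp\<close> moves
  between the two.\<close>

datatype 'v pexp = PConst rat | PVar 'v | PAdd "'v pexp" "'v pexp" | PMult "'v pexp" "'v pexp"

instance pexp :: (countable) countable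
  by countable_datatype

primrec peval :: "'v pexp \<Rightarrow> ('v \<Rightarrow> real) \<Rightarrow> real" where
  "peval (PConst c) x = of_rat c"
| "peval (PVar v) x = x v"
| "peval (PAdd p q) x = peval p x + peval q x"
| "peval (PMult p q) x = peval p x * peval q x"

lemma finite_set_pexp: "finite (set_pexp p)"
  by (induction p) auto

lemma peval_cong: "(\<And>v. v \<in> set_pexp p \<Longrightarrow> x v = y v) \<Longrightarrow> peval p x = peval p y"
  by (induction p) auto

lemma peval_map: "peval (map_pexp r p) x = peval p (x \<circ> r)"
  by (induction p) auto

lemma tendsto_peval:
  "(\<And>v. v \<in> set_pexp p \<Longrightarrow> ((\<lambda>t. x t v) \<longlongrightarrow> y v) F) \<Longrightarrow> ((\<lambda>t. peval p (x t)) \<longlongrightarrow> peval p y) F"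
  by (induction p) (auto intro!: tendsto_intros)

lemma continuous_map_peval:
  "(\<And>v. v \<in> set_pexp p \<Longrightarrow> continuous_map T euclidean (\<lambda>t. x t v)) \<Longrightarrow>
    continuous_map T euclidean (\<lambda>t. peval p (x t))"
  by (induction p) (auto intro!: continuous_map_add continuous_map_real_mult)

definition monomial_value :: "(real \<Rightarrow> real) \<Rightarrow> (real \<Rightarrow>\<^sub>0 nat) \<Rightarrow> real"
  where "monomial_value \<sigma> m = (\<Prod>x\<in>Poly_Mapping.keys m. \<sigma> x ^ Poly_Mapping.lookup m x)"

lemma monomial_value_superset:
  assumes "finite K" "Poly_Mapping.keys m \<subseteq> K"
  shows "monomial_value \<sigma> m = (\<Prod>x\<in>K. \<sigma> x ^ Poly_Mapping.lookup m x)"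
  unfolding monomial_value_def using assms
  by (intro prod.mono_neutral_left) (auto simp: not_in_keys_iff_lookup_eq_zero)

lemma monomial_value_add: "monomial_value \<sigma> (m + m') = monomial_value \<sigma> m * monomial_value \<sigma> m'"
proof -
  let ?K = "Poly_Mapping.keys m \<union> Poly_Mapping.keys m'"
  have "Poly_Mapping.keys (m + m') \<subseteq> ?K" by (rule Poly_Mapping.keys_add)
  then show ?thesis
    by (simp add: monomial_value_superset[of ?K] lookup_add power_add prod.distrib)
qed

text \<open>\<open>eval_at_indices\<close> is the case of the identity assignment. Other assignments
  are needed because a relation among the generators is to be specialised at other points.\<close>

definition poly_value :: "(real \<Rightarrow> real) \<Rightarrow> ((real \<Rightarrow>\<^sub>0 nat) \<Rightarrow>\<^sub>0 rat) \<Rightarrow> real"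
  where "poly_value \<sigma> p =
    (\<Sum>m\<in>Poly_Mapping.keys p. of_rat (Poly_Mapping.lookup p m) * monomial_value \<sigma> m)"

lemma eval_at_indices_eq: "eval_at_indices p = poly_value (\<lambda>x. x) p"
  by (simp add: eval_at_indices_def poly_value_def monomial_value_def)

lemma poly_value_superset:
  assumes "finite K" "Poly_Mapping.keys p \<subseteq> K"
  shows "poly_value \<sigma> p = (\<Sum>m\<in>K. of_rat (Poly_Mapping.lookup p m) * monomial_value \<sigma> m)"
  unfolding poly_value_def using assms
  by (intro sum.mono_neutral_left) (auto simp: not_in_keys_iff_lookup_eq_zero)

lemma poly_value_add: "poly_value \<sigma> (p + q) = poly_value \<sigma> p + poly_value \<sigma> q"
proof -
  let ?K = "Poly_Mapping.keys p \<union> Poly_Mapping.keys q"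
  have "Poly_Mapping.keys (p + q) \<subseteq> ?K" by (rule Poly_Mapping.keys_add)
  then show ?thesis
    by (simp add: poly_value_superset[of ?K] lookup_add of_rat_add distrib_right sum.distrib)
qed

lemma poly_value_single: "poly_value \<sigma> (Poly_Mapping.single m c) = of_rat c * monomial_value \<sigma> m"
  by (simp add: poly_value_superset[of "{m}"])

text \<open>An intermediate form in which monomials may repeat: a product is then just the list of
  all pairwise products, and like terms are merged only in
  \<open>terms_value_eq_poly_value\<close>.\<close>

definition terms_value :: "(real \<Rightarrow> real) \<Rightarrow> ((real \<Rightarrow>\<^sub>0 nat) \<times> rat) list \<Rightarrow> real"
  where "terms_value \<sigma> ts = (\<Sum>(m, c)\<leftarrow>ts. of_rat c * monomial_value \<sigma> m)"

lemma terms_value_mult: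
  "terms_value \<sigma> [(m + m', c * c'). (m, c) \<leftarrow> ts, (m', c') \<leftarrow> us] = terms_value \<sigma> ts * terms_value \<sigma> us"
proof (induction ts)
  case Nil
  then show ?case by (simp add: terms_value_def)
next
  case (Cons t ts)
  obtain m c where t: "t = (m, c)" by fastforce
  have "terms_value \<sigma> [(m + m', c * c'). (m', c') \<leftarrow> us] = of_rat c * monomial_value \<sigma> m * terms_value \<sigma> us"
    by (induction us) (auto simp: terms_value_def monomial_value_add of_rat_mult algebra_simps)
  then show ?case using Cons t by (simp add: terms_value_def algebra_simps)
qed

lemma peval_eq_terms_value:
  "\<exists>ts. (\<forall>(m, c)\<in>set ts. Poly_Mapping.keys m \<subseteq> set_pexp p) \<and> (\<forall>\<sigma>. peval p \<sigma> = terms_value \<sigma> ts)"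
proof (induction p)
  case (PConst c)
  show ?case by (intro exI[of _ "[(0, c)]"]) (simp add: terms_value_def monomial_value_def)
next
  case (PVar v)
  show ?case
    by (intro exI[of _ "[(Poly_Mapping.single v 1, 1)]"])
       (simp add: terms_value_def monomial_value_superset[of "{v}"])
next
  case (PAdd p q)
  then obtain ts us where
    "\<forall>(m, c)\<in>set ts. Poly_Mapping.keys m \<subseteq> set_pexp p" "\<forall>\<sigma>. peval p \<sigma> = terms_value \<sigma> ts"
    "\<forall>(m, c)\<in>set us. Poly_Mapping.keys m \<subseteq> set_pexp q" "\<forall>\<sigma>. peval q \<sigma> = terms_value \<sigma> us" by auto
  then show ?case by (intro exI[of _ "ts @ us"]) (auto simp: terms_value_def)
next
  case (PMult p q)
  then obtain ts us where
    ts: "\<forall>(m, c)\<in>set ts. Poly_Mapping.keys m \<subseteq> set_pexp p" "\<forall>\<sigma>. peval p \<sigma> = terms_value \<sigma> ts" and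
    us: "\<forall>(m, c)\<in>set us. Poly_Mapping.keys m \<subseteq> set_pexp q" "\<forall>\<sigma>. peval q \<sigma> = terms_value \<sigma> us" by auto
  show ?case
  proof (intro exI[of _ "[(m + m', c * c'). (m, c) \<leftarrow> ts, (m', c') \<leftarrow> us]"] conjI)
    show "\<forall>(m, c)\<in>set [(m + m', c * c'). (m, c) \<leftarrow> ts, (m', c') \<leftarrow> us].
        Poly_Mapping.keys m \<subseteq> set_pexp (PMult p q)"
      using ts(1) us(1) Poly_Mapping.keys_add by fastforce
    show "\<forall>\<sigma>. peval (PMult p q) \<sigma> = terms_value \<sigma> [(m + m', c * c'). (m, c) \<leftarrow> ts, (m', c') \<leftarrow> us]"
      unfolding terms_value_mult using ts(2) us(2) by simp
  qed
qed

lemma terms_value_eq_poly_value: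
  "\<exists>p. Poly_Mapping.keys p \<subseteq> fst ` set ts \<and> (\<forall>\<sigma>. terms_value \<sigma> ts = poly_value \<sigma> p)"
proof (induction ts)
  case Nil
  show ?case by (intro exI[of _ 0]) (simp add: terms_value_def poly_value_def)
next
  case (Cons t ts)
  obtain m c where t: "t = (m, c)" by fastforce
  obtain p where p: "Poly_Mapping.keys p \<subseteq> fst ` set ts" "\<forall>\<sigma>. terms_value \<sigma> ts = poly_value \<sigma> p"
    using Cons by blast
  show ?case
  proof (intro exI[of _ "Poly_Mapping.single m c + p"] conjI)
    have "Poly_Mapping.keys (Poly_Mapping.single m c + p) \<subseteq> Poly_Mapping.keys (Poly_Mapping.single m c) \<union> Poly_Mapping.keys p"
      by (rule Poly_Mapping.keys_add)
    also have "\<dots> \<subseteq> fst ` set (t # ts)" using p(1) t by auto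
    finally show "Poly_Mapping.keys (Poly_Mapping.single m c + p) \<subseteq> fst ` set (t # ts)" .
    show "\<forall>\<sigma>. terms_value \<sigma> (t # ts) = poly_value \<sigma> (Poly_Mapping.single m c + p)"
      using p(2) t by (simp add: terms_value_def poly_value_add poly_value_single)
  qed
qed

text \<open>A relation that holds at the generators themselves comes from the zero polynomial, so it
  holds under every assignment.\<close>

lemma algebraically_independent_peval:
  assumes "algebraically_independent_over_Rats C" "set_pexp p \<subseteq> C" "peval p (\<lambda>x. x) = 0"
  shows "peval p \<sigma> = 0"
proof -
  obtain ts where ts: "\<forall>(m, c)\<in>set ts. Poly_Mapping.keys m \<subseteq> set_pexp p" "\<And>\<sigma>. peval p \<sigma> = terms_value \<sigma> ts"
    using peval_eq_terms_value[of p] by auto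
  obtain P where P: "Poly_Mapping.keys P \<subseteq> fst ` set ts" "\<And>\<sigma>. terms_value \<sigma> ts = poly_value \<sigma> P"
    using terms_value_eq_poly_value[of ts] by auto
  have "\<forall>m\<in>Poly_Mapping.keys P. Poly_Mapping.keys m \<subseteq> C" using ts(1) P(1) assms(2) by fastforce
  moreover have "eval_at_indices P = 0" using assms(3) ts(2) P(2) by (simp add: eval_at_indices_eq)
  ultimately have "P = 0" using assms(1) unfolding algebraically_independent_over_Rats_def by blast
  then show ?thesis using ts(2) P(2) by (simp add: poly_value_def)
qed

section \<open>Elements of the generated field as quotients\<close>

lemma ring_of_type_algebra_simps:
  "carrier (ring_of_type_algebra :: 'a::field ring) = UNIV"
  "\<one>\<^bsub>ring_of_type_algebra\<^esub> = (1 :: 'a)" "\<zero>\<^bsub>ring_of_type_algebra\<^esub> = (0 :: 'a)"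
  "x \<oplus>\<^bsub>ring_of_type_algebra\<^esub> y = x + (y :: 'a)" "x \<otimes>\<^bsub>ring_of_type_algebra\<^esub> y = x * y"
  by (simp_all add: ring_of_type_algebra_def)

lemma ring_of_type_algebra_a_inv: "\<ominus>\<^bsub>ring_of_type_algebra\<^esub> x = - (x :: 'a::field)"
proof -
  interpret field "ring_of_type_algebra :: 'a ring" by (rule field_from_type_algebra)
  show ?thesis by (rule sum_zero_eq_neg[symmetric]) (simp_all add: ring_of_type_algebra_simps)
qed

lemma ring_of_type_algebra_m_inv:
  assumes "x \<noteq> 0"
  shows "inv\<^bsub>ring_of_type_algebra\<^esub> x = inverse (x :: 'a::field)"
proof -
  interpret field "ring_of_type_algebra :: 'a ring" by (rule field_from_type_algebra)
  show ?thesis by (rule comm_inv_char) (use assms in \<open>simp_all add: ring_of_type_algebra_simps\<close>)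
qed

lemma rat_field_generated_Rats: "x \<in> \<rat> \<Longrightarrow> x \<in> rat_field_generated X"
  unfolding rat_field_generated_def by (rule generate_field.incl) simp

lemma rat_field_generated_incl: "x \<in> X \<Longrightarrow> x \<in> rat_field_generated X"
  unfolding rat_field_generated_def by (rule generate_field.incl) simp

lemma rat_field_generated_add:
  "x \<in> rat_field_generated X \<Longrightarrow> y \<in> rat_field_generated X \<Longrightarrow> x + y \<in> rat_field_generated X"
  unfolding rat_field_generated_def
  using generate_field.eng_add[of x ring_of_type_algebra "\<rat> \<union> X" y] by (simp add: ring_of_type_algebra_simps)

lemma rat_field_generated_mult:
  "x \<in> rat_field_generated X \<Longrightarrow> y \<in> rat_field_generated X \<Longrightarrow> x * y \<in> rat_field_generated X"
  unfolding rat_field_generated_def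
  using generate_field.eng_mult[of x ring_of_type_algebra "\<rat> \<union> X" y] by (simp add: ring_of_type_algebra_simps)

lemma rat_field_generated_inverse:
  "x \<in> rat_field_generated X \<Longrightarrow> inverse x \<in> rat_field_generated X"
  unfolding rat_field_generated_def
  using generate_field.m_inv[of x ring_of_type_algebra "\<rat> \<union> X"]
  by (cases "x = 0") (simp_all add: ring_of_type_algebra_simps ring_of_type_algebra_m_inv)

lemma peval_in_rat_field_generated:
  "(\<And>v. v \<in> set_pexp p \<Longrightarrow> x v \<in> rat_field_generated X) \<Longrightarrow> peval p x \<in> rat_field_generated X"
  by (induction p) (auto intro: rat_field_generated_Rats rat_field_generated_add rat_field_generated_mult)

lemma quotient_in_rat_field_generated:
  assumes "\<And>v. v \<in> set_pexp p \<union> set_pexp q \<Longrightarrow> x v \<in> rat_field_generated X"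
  shows "peval p x / peval q x \<in> rat_field_generated X"
  unfolding divide_inverse using assms
  by (intro rat_field_generated_mult rat_field_generated_inverse peval_in_rat_field_generated) auto

lemma quotient_in_rat_field_generated_vars:
  assumes "set_pexp p \<subseteq> X" "set_pexp q \<subseteq> X"
  shows "peval p (\<lambda>x. x) / peval q (\<lambda>x. x) \<in> rat_field_generated X"
  using assms by (intro quotient_in_rat_field_generated rat_field_generated_incl) auto

lemma rat_field_generated_quotient:
  assumes "y \<in> rat_field_generated X"
  shows "\<exists>p q. set_pexp p \<subseteq> X \<and> set_pexp q \<subseteq> X \<and> peval q (\<lambda>x. x) \<noteq> 0 \<and>
    y = peval p (\<lambda>x. x) / peval q (\<lambda>x. x)"
  using assms unfolding rat_field_generated_def
proof (induction rule: generate_field.induct)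
  case one
  show ?case by (intro exI[of _ "PConst 1"]) (simp add: ring_of_type_algebra_simps)
next
  case (incl h)
  show ?case
  proof (cases "h \<in> X")
    case True
    then show ?thesis by (intro exI[of _ "PVar h"] exI[of _ "PConst 1"]) simp
  next
    case False
    then obtain c where "h = of_rat c" using incl by (auto elim: Rats_cases)
    then show ?thesis by (intro exI[of _ "PConst c"] exI[of _ "PConst 1"]) simp
  qed
next
  case (a_inv h)
  then obtain p q where pq: "set_pexp p \<subseteq> X" "set_pexp q \<subseteq> X" "peval q (\<lambda>x. x) \<noteq> 0"
    "h = peval p (\<lambda>x. x) / peval q (\<lambda>x. x)" by blast
  then show ?case
    by (intro exI[of _ "PMult (PConst (-1)) p"] exI[of _ q]) (simp add: ring_of_type_algebra_a_inv)
next
  case (m_inv h)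
  then obtain p q where pq: "set_pexp p \<subseteq> X" "set_pexp q \<subseteq> X" "peval q (\<lambda>x. x) \<noteq> 0"
    "h = peval p (\<lambda>x. x) / peval q (\<lambda>x. x)" by blast
  then show ?case using m_inv(2)
    by (intro exI[of _ q] exI[of _ p])
       (auto simp: ring_of_type_algebra_m_inv ring_of_type_algebra_simps)
next
  case (eng_add h1 h2)
  then obtain p q p' q' where pq: "set_pexp p \<subseteq> X" "set_pexp q \<subseteq> X" "peval q (\<lambda>x. x) \<noteq> 0"
    "h1 = peval p (\<lambda>x. x) / peval q (\<lambda>x. x)" and
    pq': "set_pexp p' \<subseteq> X" "set_pexp q' \<subseteq> X" "peval q' (\<lambda>x. x) \<noteq> 0"
    "h2 = peval p' (\<lambda>x. x) / peval q' (\<lambda>x. x)" by blast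
  then show ?case
    by (intro exI[of _ "PAdd (PMult p q') (PMult p' q)"] exI[of _ "PMult q q'"])
       (simp add: ring_of_type_algebra_simps add_frac_eq)
next
  case (eng_mult h1 h2)
  then obtain p q p' q' where pq: "set_pexp p \<subseteq> X" "set_pexp q \<subseteq> X" "peval q (\<lambda>x. x) \<noteq> 0"
    "h1 = peval p (\<lambda>x. x) / peval q (\<lambda>x. x)" and
    pq': "set_pexp p' \<subseteq> X" "set_pexp q' \<subseteq> X" "peval q' (\<lambda>x. x) \<noteq> 0"
    "h2 = peval p' (\<lambda>x. x) / peval q' (\<lambda>x. x)" by blast
  then show ?case
    by (intro exI[of _ "PMult p p'"] exI[of _ "PMult q q'"])
       (simp add: ring_of_type_algebra_simps)
qed

lemma rat_field_generated_mono:
  assumes "y \<in> rat_field_generated A" "A \<subseteq> B"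
  shows "y \<in> rat_field_generated B"
proof -
  obtain p q where "set_pexp p \<subseteq> A" "set_pexp q \<subseteq> A" "y = peval p (\<lambda>x. x) / peval q (\<lambda>x. x)"
    using rat_field_generated_quotient[OF assms(1)] by blast
  then show ?thesis using assms(2) quotient_in_rat_field_generated_vars[of p B q] by simp
qed

text \<open>
  Write \<open>y = p/q = p'/q'\<close> with \<open>p, q\<close> over \<open>A\<close> and \<open>p', q'\<close> over \<open>B\<close>. Algebraic independence turns
  \<open>p q' = p' q\<close> into a polynomial identity, in which the variables outside \<open>A\<close> are
  specialised to rational numbers.
\<close>

lemma rat_field_generated_Int:
  assumes C: "algebraically_independent_over_Rats C" and AB: "A \<subseteq> C" "B \<subseteq> C"
    and y: "y \<in> rat_field_generated A" "y \<in> rat_field_generated B"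
  shows "y \<in> rat_field_generated (A \<inter> B)"
proof -
  obtain p q where pq: "set_pexp p \<subseteq> A" "set_pexp q \<subseteq> A" "peval q (\<lambda>x. x) \<noteq> 0"
    "y = peval p (\<lambda>x. x) / peval q (\<lambda>x. x)"
    using rat_field_generated_quotient[OF y(1)] by blast
  obtain p' q' where pq': "set_pexp p' \<subseteq> B" "set_pexp q' \<subseteq> B" "peval q' (\<lambda>x. x) \<noteq> 0"
    "y = peval p' (\<lambda>x. x) / peval q' (\<lambda>x. x)"
    using rat_field_generated_quotient[OF y(2)] by blast
  define r where "r = PAdd (PMult p q') (PMult (PConst (-1)) (PMult p' q))"
  have "set_pexp r \<subseteq> C" using pq pq' AB by (auto simp: r_def)
  moreover have "peval r (\<lambda>x. x) = 0"
    using pq(3,4) pq'(3,4) by (simp add: r_def field_simps)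
  ultimately have r: "peval r \<sigma> = 0" for \<sigma>
    using algebraically_independent_peval[OF C] by blast
  \<comment> \<open>Variables in \<open>A\<close> keep their values, so \<open>p\<close> and
    \<open>q\<close> are unaffected; the others are rounded down to multiples of
    \<open>1 / (n + 1)\<close>, which are rational. These points converge to the original one, where
    \<open>q'\<close> does not vanish, so \<open>q'\<close> is nonzero at one of them, and there
    \<open>p' / q'\<close> represents \<open>y\<close> with inputs that are rational or in
    \<open>A \<inter> B\<close>.\<close>
  define \<sigma> where "\<sigma> n x = (if x \<in> A then x else real_of_int \<lfloor>real (Suc n) * x\<rfloor> / real (Suc n))" for n x
  have "(\<lambda>n. real_of_int \<lfloor>real (Suc n) * x\<rfloor> / real (Suc n)) \<longlonglongrightarrow> x" for x
  proof (rule tendsto_sandwich)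
    show "\<forall>\<^sub>F n in sequentially. x - 1 / real (Suc n) \<le> real_of_int \<lfloor>real (Suc n) * x\<rfloor> / real (Suc n)"
    proof (intro always_eventually allI)
      fix n
      have "real (Suc n) * x - 1 \<le> real_of_int \<lfloor>real (Suc n) * x\<rfloor>" by linarith
      then have "(real (Suc n) * x - 1) / real (Suc n) \<le> real_of_int \<lfloor>real (Suc n) * x\<rfloor> / real (Suc n)"
        by (intro divide_right_mono) auto
      then show "x - 1 / real (Suc n) \<le> real_of_int \<lfloor>real (Suc n) * x\<rfloor> / real (Suc n)"
        by (simp add: diff_divide_distrib del: of_nat_Suc)
    qed
    show "\<forall>\<^sub>F n in sequentially. real_of_int \<lfloor>real (Suc n) * x\<rfloor> / real (Suc n) \<le> x"
      by (intro always_eventually allI) (simp add: divide_le_eq mult.commute)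
    have "(\<lambda>n. x - 1 / real (Suc n)) \<longlonglongrightarrow> x - 0"
      by (intro tendsto_intros LIMSEQ_Suc[OF lim_1_over_n, unfolded o_def])
    then show "(\<lambda>n. x - 1 / real (Suc n)) \<longlonglongrightarrow> x" by simp
  qed simp
  then have "(\<lambda>n. \<sigma> n x) \<longlonglongrightarrow> x" for x by (cases "x \<in> A") (simp_all add: \<sigma>_def)
  then have "(\<lambda>n. peval q' (\<sigma> n)) \<longlonglongrightarrow> peval q' (\<lambda>x. x)" by (intro tendsto_peval)
  then have "\<forall>\<^sub>F n in sequentially. peval q' (\<sigma> n) \<noteq> 0"
    using pq'(3) by (rule tendsto_imp_eventually_ne)
  then obtain n where n: "peval q' (\<sigma> n) \<noteq> 0" by (auto simp: eventually_sequentially)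
  have "peval p (\<sigma> n) = peval p (\<lambda>x. x)" "peval q (\<sigma> n) = peval q (\<lambda>x. x)"
    using pq(1,2) by (auto intro!: peval_cong simp: \<sigma>_def)
  then have "y = peval p' (\<sigma> n) / peval q' (\<sigma> n)"
    using r[of "\<sigma> n"] n pq(3,4) by (simp add: r_def frac_eq_eq)
  moreover have "\<sigma> n v \<in> rat_field_generated (A \<inter> B)" if "v \<in> set_pexp p' \<union> set_pexp q'" for v
  proof (cases "v \<in> A")
    case True
    then show ?thesis using that pq'(1,2) by (auto simp: \<sigma>_def intro: rat_field_generated_incl)
  next
    case False
    then show ?thesis by (auto simp: \<sigma>_def intro!: rat_field_generated_Rats Rats_divide)
  qed
  ultimately show ?thesis using quotient_in_rat_field_generated by blast
qed

definition field_support :: "real set \<Rightarrow> real \<Rightarrow> real set"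
  where "field_support C y = \<Inter>{A. finite A \<and> A \<subseteq> C \<and> y \<in> rat_field_generated A}"

text \<open>A finite generating set \<open>A\<close> of least cardinality lies in every other such
  set \<open>B\<close>, because \<open>A \<inter> B\<close> generates \<open>y\<close> as well.
  Hence the intersection that defines the support is attained.\<close>

lemma field_support:
  assumes C: "algebraically_independent_over_Rats C" and y: "y \<in> rat_field_generated C"
  shows "finite (field_support C y)" "field_support C y \<subseteq> C" "y \<in> rat_field_generated (field_support C y)"
proof -
  let ?P = "\<lambda>A. finite A \<and> A \<subseteq> C \<and> y \<in> rat_field_generated A"
  obtain p q where pq: "set_pexp p \<subseteq> C" "set_pexp q \<subseteq> C" "y = peval p (\<lambda>x. x) / peval q (\<lambda>x. x)"
    using rat_field_generated_quotient[OF y] by blast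
  have "?P (set_pexp p \<union> set_pexp q)"
    using pq finite_set_pexp quotient_in_rat_field_generated_vars[of p "set_pexp p \<union> set_pexp q" q] by simp
  from ex_has_least_nat[of ?P, OF this, of card]
  obtain A where "?P A \<and> (\<forall>B. ?P B \<longrightarrow> card A \<le> card B)" ..
  then have A: "?P A" "\<And>B. ?P B \<Longrightarrow> card A \<le> card B" by simp_all
  have "A \<subseteq> B" if B: "?P B" for B
  proof -
    have "?P (A \<inter> B)" using rat_field_generated_Int[OF C, of A B y] A(1) B by auto
    then have "card A \<le> card (A \<inter> B)" by (rule A(2))
    then have "A \<inter> B = A" using A(1) by (intro card_seteq) auto
    then show ?thesis by blast
  qed
  then have "field_support C y = A" unfolding field_support_def using A(1) by blast
  then show "finite (field_support C y)" "field_support C y \<subseteq> C" "y \<in> rat_field_generated (field_support C y)"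
    using A(1) by auto
qed

text \<open>For infinite \<open>A\<close>, the finitely many variables of one quotient representing
  \<open>y\<close> already form a generating set inside \<open>A\<close>.\<close>

lemma field_support_subset:
  assumes C: "algebraically_independent_over_Rats C" and A: "A \<subseteq> C" "y \<in> rat_field_generated A"
  shows "field_support C y \<subseteq> A"
proof -
  obtain p q where pq: "set_pexp p \<subseteq> A" "set_pexp q \<subseteq> A" "y = peval p (\<lambda>x. x) / peval q (\<lambda>x. x)"
    using rat_field_generated_quotient[OF A(2)] by blast
  have "y \<in> rat_field_generated (set_pexp p \<union> set_pexp q)"
    using pq quotient_in_rat_field_generated_vars[of p "set_pexp p \<union> set_pexp q" q] by simp
  then have "field_support C y \<subseteq> set_pexp p \<union> set_pexp q"
    unfolding field_support_def using pq(1,2) A(1) finite_set_pexp by (intro Inter_lower) auto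
  then show ?thesis using pq(1,2) by blast
qed

text \<open>Renaming along a right inverse of \<open>x\<close> replaces variables that are reals by
  their indices.\<close>

lemma rat_field_generated_image:
  fixes x :: "'v \<Rightarrow> real"
  assumes "y \<in> rat_field_generated (x ` V)"
  obtains p q where "set_pexp p \<subseteq> V" "set_pexp q \<subseteq> V" "peval q x \<noteq> 0" "y = peval p x / peval q x"
proof -
  obtain p q where pq: "set_pexp p \<subseteq> x ` V" "set_pexp q \<subseteq> x ` V" "peval q (\<lambda>x. x) \<noteq> 0"
    "y = peval p (\<lambda>x. x) / peval q (\<lambda>x. x)"
    using rat_field_generated_quotient[OF assms] by blast
  let ?r = "inv_into V x"
  have "peval (map_pexp ?r s) x = peval s (\<lambda>x. x)" if "set_pexp s \<subseteq> x ` V" for s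
    unfolding peval_map using that by (intro peval_cong) (auto simp: f_inv_into_f)
  moreover have "set_pexp (map_pexp ?r s) \<subseteq> V" if "set_pexp s \<subseteq> x ` V" for s
    using that inv_into_into[of _ x V] by (auto simp: pexp.set_map)
  ultimately show ?thesis using pq by (intro that[of "map_pexp ?r p" "map_pexp ?r q"]) simp_all
qed

lemma countable_rat_field_generated:
  assumes "finite A"
  shows "countable (rat_field_generated A)"
proof -
  obtain n and x :: "nat \<Rightarrow> real" where A: "A = x ` {..<n}"
    using finite_imp_nat_seg_image_inj_on[OF assms] unfolding lessThan_def by blast
  have "rat_field_generated A \<subseteq> range (\<lambda>(p, q). peval p x / peval q x)"
  proof
    fix y assume "y \<in> rat_field_generated A"
    then obtain p q where "y = peval p x / peval q x" using rat_field_generated_image A by metis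
    then show "y \<in> range (\<lambda>(p, q). peval p x / peval q x)" by (intro image_eqI[of _ _ "(p, q)"]) auto
  qed
  then show ?thesis by (rule countable_subset) simp
qed

section \<open>Borel dependence of the support on the element\<close>

lemma continuous_on_peval: "continuous_on S (peval p)"
  by (induction p) (auto intro!: continuous_intros continuous_on_product_coordinates[THEN continuous_on_subset])

text \<open>The quotient is continuous only off the zeros of \<open>q\<close>, so its domain is
  exhausted by the compact sets on which the denominator has absolute value at least
  \<open>1 / (n + 1)\<close>. The image is therefore sigma-compact, where a general continuous image
  would only be analytic.\<close>

lemma borel_quotient_image:
  fixes C :: "real set" and R :: "(nat \<Rightarrow> real) set"
  assumes C: "compact C" and R: "closed R"
  shows "{peval p x / peval q x | x. (\<forall>j. x j \<in> C) \<and> x \<in> R \<and> peval q x \<noteq> 0} \<in> sets borel"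
proof -
  define K where "K n = {x. \<forall>j. x j \<in> C} \<inter> R \<inter> {x. 1 / real (Suc n) \<le> \<bar>peval q x\<bar>}" for n
  have "compact {x :: nat \<Rightarrow> real. \<forall>j. x j \<in> C}"
  proof -
    have "compactin (product_topology (\<lambda>_. euclidean) (UNIV :: nat set)) (\<Pi>\<^sub>E _\<in>UNIV. C)"
      using C by (simp add: compactin_PiE)
    moreover have "(\<Pi>\<^sub>E _\<in>UNIV. C) = {x :: nat \<Rightarrow> real. \<forall>j. x j \<in> C}" by (auto simp: PiE_UNIV_domain)
    ultimately show ?thesis by (simp add: euclidean_product_topology flip: compactin_euclidean_iff)
  qed
  moreover have "closed {x :: nat \<Rightarrow> real. 1 / real (Suc n) \<le> \<bar>peval q x\<bar>}" for n
    by (intro closed_Collect_le continuous_intros continuous_on_peval)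
  ultimately have K: "compact (K n)" for n
    using R unfolding K_def by (intro compact_Int_closed)
  have nz: "peval q x \<noteq> 0" if "x \<in> K n" for x n
  proof -
    have "0 < 1 / real (Suc n)" by simp
    then show ?thesis using that unfolding K_def by auto
  qed
  have "compact ((\<lambda>x. peval p x / peval q x) ` K n)" for n
    using K nz by (intro compact_continuous_image continuous_intros continuous_on_peval) auto
  then have "(\<Union>n. (\<lambda>x. peval p x / peval q x) ` K n) \<in> sets borel"
    by (intro sets.countable_UN'') (auto intro: borel_compact)
  moreover have "{peval p x / peval q x | x. (\<forall>j. x j \<in> C) \<and> x \<in> R \<and> peval q x \<noteq> 0} =
      (\<Union>n. (\<lambda>x. peval p x / peval q x) ` K n)"
  proof (intro equalityI subsetI)
    fix y assume "y \<in> {peval p x / peval q x | x. (\<forall>j. x j \<in> C) \<and> x \<in> R \<and> peval q x \<noteq> 0}"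
    then obtain x where x: "y = peval p x / peval q x" "\<forall>j. x j \<in> C" "x \<in> R" "peval q x \<noteq> 0" by blast
    obtain n where "inverse (real (Suc n)) < \<bar>peval q x\<bar>" using reals_Archimedean[of "\<bar>peval q x\<bar>"] x(4) by auto
    then have "x \<in> K n" using x by (simp add: K_def inverse_eq_divide)
    then show "y \<in> (\<Union>n. (\<lambda>x. peval p x / peval q x) ` K n)" using x(1) by blast
  next
    fix y assume "y \<in> (\<Union>n. (\<lambda>x. peval p x / peval q x) ` K n)"
    then obtain n x where x: "x \<in> K n" "y = peval p x / peval q x" by blast
    then show "y \<in> {peval p x / peval q x | x. (\<forall>j. x j \<in> C) \<and> x \<in> R \<and> peval q x \<noteq> 0}"
      using nz[OF x(1)] unfolding K_def by blast
  qed
  ultimately show ?thesis by simp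
qed

definition support_nth :: "real set \<Rightarrow> nat \<Rightarrow> real \<Rightarrow> real"
  where "support_nth C i y = sorted_list_of_set (field_support C y) ! i"

lemma support_nth_image:
  assumes "finite (field_support C y)"
  shows "(\<lambda>i. support_nth C i y) ` {..<card (field_support C y)} = field_support C y"
proof -
  have "(!) (sorted_list_of_set (field_support C y)) ` {..<length (sorted_list_of_set (field_support C y))} =
      set (sorted_list_of_set (field_support C y))"
    by (auto simp: set_conv_nth)
  then show ?thesis using assms by (simp add: support_nth_def)
qed

text \<open>The elements obtained from \<open>k\<close> points of \<open>C\<close> subject to a
  constraint \<open>R\<close>. The points come as infinite sequences in \<open>C\<close>, of which
  the expressions read the first \<open>k\<close> entries, so that one compact product serves every
  \<open>k\<close>.\<close>

definition quotient_values :: "real set \<Rightarrow> nat \<Rightarrow> (nat \<Rightarrow> real) set \<Rightarrow> real set"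
  where "quotient_values C k R = (\<Union>(p, q)\<in>{(p, q). set_pexp p \<union> set_pexp q \<subseteq> {..<k}}.
    {peval p x / peval q x | x. (\<forall>j. x j \<in> C) \<and> x \<in> R \<and> peval q x \<noteq> 0})"

lemma borel_quotient_values:
  assumes "compact C" "closed R"
  shows "quotient_values C k R \<in> sets borel"
  unfolding quotient_values_def case_prod_unfold
  by (intro sets.countable_UN') (auto intro!: borel_quotient_image assms)

lemma quotient_valuesI:
  assumes "y \<in> rat_field_generated (x ` {..<k})" "\<And>j. x j \<in> C" "x \<in> R"
  shows "y \<in> quotient_values C k R"
proof -
  obtain p q where pq: "set_pexp p \<subseteq> {..<k}" "set_pexp q \<subseteq> {..<k}" "peval q x \<noteq> 0" "y = peval p x / peval q x"
    by (rule rat_field_generated_image[OF assms(1)])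
  show ?thesis
    unfolding quotient_values_def
  proof (rule UN_I[of "(p, q)"])
    show "y \<in> (case (p, q) of (p, q) \<Rightarrow> {peval p x / peval q x | x. (\<forall>j. x j \<in> C) \<and> x \<in> R \<and> peval q x \<noteq> 0})"
      unfolding prod.case using pq(3,4) assms(2,3) by blast
  qed (use pq(1,2) in simp)
qed

lemma quotient_valuesD:
  assumes "y \<in> quotient_values C k R"
  shows "\<exists>x\<in>R. (\<forall>j. x j \<in> C) \<and> y \<in> rat_field_generated (x ` {..<k})"
proof -
  obtain p q x where *: "set_pexp p \<union> set_pexp q \<subseteq> {..<k}" "\<forall>j. x j \<in> C" "x \<in> R" "y = peval p x / peval q x"
    using assms unfolding quotient_values_def by blast
  have "y \<in> rat_field_generated (x ` {..<k})"
    unfolding *(4) using *(1) by (intro quotient_in_rat_field_generated rat_field_generated_incl) blast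
  then show ?thesis using * by blast
qed

text \<open>The padding by \<open>c\<close> keeps every entry of the sequence in \<open>C\<close>,
  as \<open>quotient_values\<close> demands.\<close>

lemma field_support_enumeration:
  assumes C: "algebraically_independent_over_Rats C" and c: "c \<in> C"
    and y: "y \<in> rat_field_generated C"
  defines "x \<equiv> \<lambda>j. if j < card (field_support C y) then support_nth C j y else c"
  shows "x j \<in> C" "x ` {..<card (field_support C y)} = field_support C y"
proof -
  have fin: "finite (field_support C y)" and sub: "field_support C y \<subseteq> C"
    using field_support[OF C y] by blast+
  show img: "x ` {..<card (field_support C y)} = field_support C y"
    using support_nth_image[OF fin] by (auto simp: x_def)
  show "x j \<in> C"
  proof (cases "j < card (field_support C y)")
    case True
    then have "x j \<in> field_support C y" using img by blast
    then show ?thesis using sub by blast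
  qed (simp add: x_def c)
qed

lemma card_field_support_quotient_values:
  assumes C: "algebraically_independent_over_Rats C" and y: "y \<in> quotient_values C k R"
  shows "y \<in> rat_field_generated C" "card (field_support C y) \<le> k"
proof -
  obtain x where x: "\<forall>j. x j \<in> C" "x \<in> R" "y \<in> rat_field_generated (x ` {..<k})"
    using quotient_valuesD[OF y] by blast
  have sub: "x ` {..<k} \<subseteq> C" using x(1) by blast
  then show "y \<in> rat_field_generated C" using x(3) rat_field_generated_mono by blast
  have "card (field_support C y) \<le> card (x ` {..<k})"
    using field_support_subset[OF C sub x(3)] by (intro card_mono) auto
  also have "\<dots> \<le> k" using card_image_le[of "{..<k}" x] by simp
  finally show "card (field_support C y) \<le> k" .
qed

text \<open>Support size \<open>k\<close> means reachable from \<open>k\<close> points but not from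
  \<open>k - 1\<close>, a difference of two Borel sets. A nondecreasing tuple of \<open>k\<close>
  points that reaches such an element has to list its support in increasing order, so bounding entry
  \<open>i\<close> of the tuple bounds \<open>support_nth C i\<close>.\<close>

lemma borel_support_nth_le:
  assumes C: "algebraically_independent_over_Rats C" and comp: "compact C" and i: "i < k"
  shows "{y \<in> rat_field_generated C. card (field_support C y) = k \<and> support_nth C i y \<le> a} \<in> sets borel"
proof (cases "C = {}")
  case True
  have "card (field_support C y) = 0" if "y \<in> rat_field_generated C" for y
    using field_support(2)[OF C that] True by simp
  then have "{y \<in> rat_field_generated C. card (field_support C y) = k \<and> support_nth C i y \<le> a} = {}"
    using i by fastforce
  then show ?thesis by (simp only: sets.empty_sets)
next
  case False
  then obtain c where c: "c \<in> C" by blast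
  define R where "R = {x :: nat \<Rightarrow> real. (\<forall>j. Suc j < k \<longrightarrow> x j \<le> x (Suc j)) \<and> x i \<le> a}"
  have "R = (\<Inter>j\<in>{j. Suc j < k}. {x. x j \<le> x (Suc j)}) \<inter> {x. x i \<le> a}" by (auto simp: R_def)
  moreover have "closed {x :: nat \<Rightarrow> real. x j \<le> x (Suc j)}" "closed {x :: nat \<Rightarrow> real. x i \<le> a}" for j
    by (intro closed_Collect_le continuous_on_product_coordinates continuous_on_const)+
  ultimately have R: "closed R" by auto
  have "{y \<in> rat_field_generated C. card (field_support C y) = k \<and> support_nth C i y \<le> a} =
      quotient_values C k R - quotient_values C (k - 1) UNIV"
  proof (intro equalityI subsetI)
    fix y assume "y \<in> {y \<in> rat_field_generated C. card (field_support C y) = k \<and> support_nth C i y \<le> a}"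
    then have y: "y \<in> rat_field_generated C" "card (field_support C y) = k" "support_nth C i y \<le> a" by auto
    define x where "x = (\<lambda>j. if j < card (field_support C y) then support_nth C j y else c)"
    have x: "x j \<in> C" "x ` {..<k} = field_support C y" for j
      using field_support_enumeration[OF C c y(1)] unfolding x_def y(2) by auto
    have "x j \<le> x (Suc j)" if "Suc j < k" for j
      using that y(2) field_support(1)[OF C y(1)]
      by (auto simp: x_def support_nth_def intro!: sorted_nth_mono)
    then have "x \<in> R" using y(2,3) i by (auto simp: R_def x_def)
    then have "y \<in> quotient_values C k R"
      using x field_support(3)[OF C y(1)] by (intro quotient_valuesI) auto
    moreover have "y \<notin> quotient_values C (k - 1) UNIV"
      using card_field_support_quotient_values(2)[OF C, of y "k - 1"] y(2) i by fastforce
    ultimately show "y \<in> quotient_values C k R - quotient_values C (k - 1) UNIV" by blast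
  next
    fix y assume y: "y \<in> quotient_values C k R - quotient_values C (k - 1) UNIV"
    then obtain x where x: "\<forall>j. x j \<in> C" "x \<in> R" "y \<in> rat_field_generated (x ` {..<k})"
      using quotient_valuesD[of y C k R] by blast
    have yC: "y \<in> rat_field_generated C" and le: "card (field_support C y) \<le> k"
      using card_field_support_quotient_values[OF C] y by blast+
    note supp = field_support[OF C yC]
    have "\<not> card (field_support C y) \<le> k - 1"
    proof
      assume le': "card (field_support C y) \<le> k - 1"
      define x' where "x' = (\<lambda>j. if j < card (field_support C y) then support_nth C j y else c)"
      have x': "x' j \<in> C" "x' ` {..<card (field_support C y)} = field_support C y" for j
        using field_support_enumeration[OF C c yC] unfolding x'_def by auto
      have "y \<in> rat_field_generated (x' ` {..<k - 1})"
      proof (rule rat_field_generated_mono)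
        show "y \<in> rat_field_generated (x' ` {..<card (field_support C y)})" using supp(3) by (simp only: x'(2))
        show "x' ` {..<card (field_support C y)} \<subseteq> x' ` {..<k - 1}" using le' by (intro image_mono) simp
      qed
      then show False using y x'(1) quotient_valuesI[of y x' "k - 1" C UNIV] by simp
    qed
    then have card: "card (field_support C y) = k" using le by simp
    have "x ` {..<k} \<subseteq> C" using x(1) by blast
    then have sub: "field_support C y \<subseteq> x ` {..<k}" using x(3) by (rule field_support_subset[OF C])
    \<comment> \<open>The at most \<open>k\<close> points contain a support of size
      \<open>k\<close>; hence they are distinct and exhaust it.\<close>
    have img: "x ` {..<k} = field_support C y"
      using card_image_le[of "{..<k}" x] card by (intro card_seteq[symmetric] sub) auto
    then have "inj_on x {..<k}" using card by (intro eq_card_imp_inj_on) auto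
    moreover have "sorted (map x [0..<k])" using x(2) by (auto simp: sorted_iff_nth_Suc R_def)
    ultimately have "sorted_list_of_set (set (map x [0..<k])) = map x [0..<k]"
      by (intro sorted_list_of_set.idem_if_sorted_distinct) (auto simp: distinct_map lessThan_atLeast0)
    moreover have "set (map x [0..<k]) = field_support C y" using img by (simp add: lessThan_atLeast0)
    ultimately have "support_nth C i y = x i" using i by (simp add: support_nth_def)
    then show "y \<in> {y \<in> rat_field_generated C. card (field_support C y) = k \<and> support_nth C i y \<le> a}"
      using yC card x(2) by (auto simp: R_def)
  qed
  then show ?thesis using borel_quotient_values[OF comp] R by auto
qed

lemma measurable_support_nth:
  assumes C: "algebraically_independent_over_Rats C" "compact C" and i: "i < k"
    and \<psi>: "\<psi> \<in> borel_measurable (restrict_space borel Z)"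
    and Z: "\<And>z. z \<in> Z \<Longrightarrow> \<psi> z \<in> rat_field_generated C \<and> card (field_support C (\<psi> z)) = k"
  shows "(\<lambda>z. support_nth C i (\<psi> z)) \<in> borel_measurable (restrict_space borel Z)"
proof (rule borel_measurableI_le)
  fix a
  let ?E = "{y \<in> rat_field_generated C. card (field_support C y) = k \<and> support_nth C i y \<le> a}"
  have "\<psi> -` ?E \<inter> space (restrict_space borel Z) \<in> sets (restrict_space borel Z)"
    using \<psi> by (rule measurable_sets) (rule borel_support_nth_le[OF C i])
  moreover have "\<psi> -` ?E \<inter> space (restrict_space borel Z) =
      {z \<in> space (restrict_space borel Z). support_nth C i (\<psi> z) \<le> a}"
    using Z by (auto simp: space_restrict_space)
  ultimately show "{z \<in> space (restrict_space borel Z). support_nth C i (\<psi> z) \<le> a} \<in> sets (restrict_space borel Z)"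
    by simp
qed

text \<open>\<open>Z\<close> is cut according to the list of support sizes, of which there are
  countably many. On one piece the support entries are finitely many Borel maps into
  \<open>X\<close>; once their values are fixed, every \<open>\<psi> j z\<close> lies in a finitely
  generated, hence countable, field.\<close>

lemma (in fubini_ideal) field_power_in:
  fixes \<psi> :: "nat \<Rightarrow> real \<Rightarrow> real"
  assumes C: "algebraically_independent_over_Rats C" "compact C" and XC: "X \<subseteq> C"
    and X: "\<And>Z s. s \<in> borel_measurable (restrict_space borel Z) \<Longrightarrow> s ` Z \<subseteq> X \<Longrightarrow>
      (\<And>x. {z \<in> Z. s z = x} \<in> I) \<Longrightarrow> Z \<in> I"
    and \<psi>: "\<And>j. j < n \<Longrightarrow> \<psi> j \<in> borel_measurable (restrict_space borel Z)"
    and \<psi>X: "\<And>j z. j < n \<Longrightarrow> z \<in> Z \<Longrightarrow> \<psi> j z \<in> rat_field_generated X"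
    and inj: "\<And>z w. z \<in> Z \<Longrightarrow> w \<in> Z \<Longrightarrow> (\<And>j. j < n \<Longrightarrow> \<psi> j z = \<psi> j w) \<Longrightarrow> z = w"
  shows "Z \<in> I"
proof -
  have \<psi>C: "\<psi> j z \<in> rat_field_generated C" if "j < n" "z \<in> Z" for j z
    using \<psi>X[OF that] XC by (rule rat_field_generated_mono)
  define Z' where "Z' \<kappa> = {z \<in> Z. \<forall>j<n. card (field_support C (\<psi> j z)) = \<kappa> ! j}" for \<kappa>
  have Z': "Z' \<kappa> \<in> I" for \<kappa>
  proof (rule countable_to_one_in[OF X])
    let ?J = "SIGMA j:{..<n}. {..<\<kappa> ! j}"
    let ?s = "\<lambda>(j, i) z. support_nth C i (\<psi> j z)"
    show "finite ?J" by simp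
    show "?s ji \<in> borel_measurable (restrict_space borel (Z' \<kappa>))" if hji: "ji \<in> ?J" for ji
    proof -
      obtain j i where ji: "ji = (j, i)" "j < n" "i < \<kappa> ! j" using hji by auto
      have "\<psi> j \<in> borel_measurable (restrict_space borel (Z' \<kappa>))"
        by (rule measurable_restrict_mono[OF \<psi>[OF ji(2)]]) (auto simp: Z'_def)
      then show ?thesis
        unfolding ji(1) prod.case using ji(2) \<psi>C
        by (intro measurable_support_nth[OF C ji(3)]) (auto simp: Z'_def)
    qed
    show "?s ji ` Z' \<kappa> \<subseteq> X" if hji: "ji \<in> ?J" for ji
    proof clarify
      fix z assume z: "z \<in> Z' \<kappa>"
      obtain j i where ji: "ji = (j, i)" "j < n" "i < \<kappa> ! j" using hji by auto
      have zZ: "z \<in> Z" "card (field_support C (\<psi> j z)) = \<kappa> ! j" using z ji(2) by (auto simp: Z'_def)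
      have "support_nth C i (\<psi> j z) \<in> (\<lambda>i. support_nth C i (\<psi> j z)) ` {..<card (field_support C (\<psi> j z))}"
        using zZ(2) ji(3) by simp
      also have "\<dots> = field_support C (\<psi> j z)"
        by (rule support_nth_image[OF field_support(1)[OF C(1) \<psi>C[OF ji(2) zZ(1)]]])
      \<comment> \<open>The support is formed relative to \<open>C\<close>, whose compactness gives
        measurability, and yet it lies in \<open>X\<close>.\<close>
      also have "\<dots> \<subseteq> X" using field_support_subset[OF C(1) XC \<psi>X[OF ji(2) zZ(1)]] .
      finally show "?s ji z \<in> X" using ji(1) by simp
    qed
    fix c :: "nat \<times> nat \<Rightarrow> real"
    let ?D = "\<lambda>j. (\<lambda>i. c (j, i)) ` {..<\<kappa> ! j}"
    let ?W = "{z \<in> Z' \<kappa>. \<forall>ji\<in>?J. ?s ji z = c ji}"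
    have "\<psi> j z \<in> rat_field_generated (?D j)" if z: "z \<in> ?W" and j: "j < n" for j z
    proof -
      have zZ: "z \<in> Z" "card (field_support C (\<psi> j z)) = \<kappa> ! j" using z j by (auto simp: Z'_def)
      note supp = field_support[OF C(1) \<psi>C[OF j zZ(1)]]
      have "?D j = (\<lambda>i. support_nth C i (\<psi> j z)) ` {..<\<kappa> ! j}"
        using z j by (intro image_cong) auto
      then have "?D j = field_support C (\<psi> j z)" using support_nth_image[OF supp(1)] zZ(2) by simp
      then show ?thesis using supp(3) by simp
    qed
    then have "(\<lambda>z. restrict (\<lambda>j. \<psi> j z) {..<n}) ` ?W \<subseteq> (\<Pi>\<^sub>E j\<in>{..<n}. rat_field_generated (?D j))"
      by (intro image_subsetI PiE_I) (simp_all only: restrict_apply lessThan_iff if_True if_False)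
    moreover have "countable (\<Pi>\<^sub>E j\<in>{..<n}. rat_field_generated (?D j))"
      by (intro countable_PiE countable_rat_field_generated) auto
    ultimately have "countable ((\<lambda>z. restrict (\<lambda>j. \<psi> j z) {..<n}) ` ?W)" by (rule countable_subset)
    moreover have "inj_on (\<lambda>z. restrict (\<lambda>j. \<psi> j z) {..<n}) ?W"
    proof (rule inj_onI)
      fix z w assume zw: "z \<in> ?W" "w \<in> ?W" "restrict (\<lambda>j. \<psi> j z) {..<n} = restrict (\<lambda>j. \<psi> j w) {..<n}"
      have "\<psi> j z = \<psi> j w" if "j < n" for j using fun_cong[OF zw(3), of j] that by simp
      then show "z = w" using inj zw(1,2) by (auto simp: Z'_def)
    qed
    ultimately show "countable ?W" by (rule countable_image_inj_on)
  qed
  have "Z \<subseteq> (\<Union>\<kappa>. Z' \<kappa>)"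
  proof
    fix z assume "z \<in> Z"
    then have "z \<in> Z' (map (\<lambda>j. card (field_support C (\<psi> j z))) [0..<n])" by (simp add: Z'_def)
    then show "z \<in> (\<Union>\<kappa>. Z' \<kappa>)" by blast
  qed
  moreover have "(\<Union>\<kappa>. Z' \<kappa>) \<in> I" using Z' by (intro UN_in) auto
  ultimately show ?thesis using subset_in by blast
qed

section \<open>Powers of the generated field\<close>

lemma metrizable_space_finite_power:
  fixes Y :: "'a::metric_space set"
  shows "metrizable_space (finite_power Y n)"
proof -
  have "countable {i \<in> {..<n}. \<nexists>a. Y \<subseteq> {a}}"
    by (rule countable_subset[of _ "{..<n}"]) auto
  then show ?thesis
    unfolding finite_power_def metrizable_space_product_topology
    by (simp add: metrizable_space_subtopology metrizable_space_euclidean)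
qed

lemma separable_space_finite_power:
  fixes Y :: "'a::{metric_space, second_countable_topology} set"
  shows "separable_space (finite_power Y n)"
proof -
  obtain D where D: "countable D" "D \<subseteq> Y" "Y \<subseteq> closure D" by (rule separable)
  have "top_of_set Y closure_of D = Y"
    using D(2,3) by (auto simp: closure_of_subtopology Int_absorb1)
  then have "finite_power Y n closure_of ({..<n} \<rightarrow>\<^sub>E D) = topspace (finite_power Y n)"
    by (simp add: finite_power_def closure_of_product_topology)
  moreover have "countable ({..<n} \<rightarrow>\<^sub>E D)" using D(1) by (intro countable_PiE) auto
  moreover have "({..<n} \<rightarrow>\<^sub>E D) \<subseteq> topspace (finite_power Y n)"
    using D(2) by (auto simp: finite_power_def PiE_iff)
  ultimately show ?thesis unfolding separable_space_def by blast
qed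

lemma measurable_finite_power_component:
  fixes Y :: "real set"
  assumes j: "j < n"
  shows "(\<lambda>x. x j) \<in> borel_measurable (borel_measure_of (finite_power Y n))"
proof (rule borel_measurableI)
  fix U :: "real set" assume U: "open U"
  have sp: "space (borel_measure_of (finite_power Y n)) = topspace (finite_power Y n)"
    and st: "sets (borel_measure_of (finite_power Y n)) =
      sigma_sets (topspace (finite_power Y n)) {U. openin (finite_power Y n) U}"
    unfolding borel_measure_of_def using openin_subset[of "finite_power Y n"]
    by (auto intro!: space_measure_of sets_measure_of)
  have "continuous_map (finite_power Y n) (top_of_set Y) (\<lambda>x. x j)"
    unfolding finite_power_def using j by (intro continuous_map_product_projection) simp
  then have "continuous_map (finite_power Y n) euclidean (\<lambda>x. x j)"
    by (simp add: continuous_map_in_subtopology)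
  from openin_continuous_map_preimage[OF this, of U]
  have "openin (finite_power Y n) {x \<in> topspace (finite_power Y n). x j \<in> U}" using U by simp
  moreover have "(\<lambda>x. x j) -` U \<inter> space (borel_measure_of (finite_power Y n)) =
      {x \<in> topspace (finite_power Y n). x j \<in> U}" unfolding sp by auto
  ultimately show "(\<lambda>x. x j) -` U \<inter> space (borel_measure_of (finite_power Y n)) \<in> sets (borel_measure_of (finite_power Y n))"
    unfolding st by (simp add: sigma_sets.Basic)
qed

lemma measurable_borel_measure_of_subspace:
  fixes Z :: "real set"
  assumes "f \<in> measurable (borel_measure_of (top_of_set Z)) M"
  shows "f \<in> measurable (restrict_space borel Z) M"
proof -
  have sp: "space (borel_measure_of (top_of_set Z)) = Z"
    and st: "sets (borel_measure_of (top_of_set Z)) = sigma_sets Z {U. openin (top_of_set Z) U}"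
    unfolding borel_measure_of_def using openin_subset[of "top_of_set Z"]
    by (auto intro!: space_measure_of sets_measure_of)
  have "U \<in> sets (restrict_space borel Z)" if "openin (top_of_set Z) U" for U
  proof -
    obtain V where "open V" "U = Z \<inter> V" using \<open>openin (top_of_set Z) U\<close> unfolding openin_open by blast
    then show ?thesis unfolding sets_restrict_space by (intro image_eqI[of _ _ V]) auto
  qed
  then have "sigma_sets Z {U. openin (top_of_set Z) U} \<subseteq> sets (restrict_space borel Z)"
    using sets.sigma_sets_subset[of "{U. openin (top_of_set Z) U}" "restrict_space borel Z"]
    by (auto simp: space_restrict_space)
  then show ?thesis
    using assms unfolding measurable_def sp st by (auto simp: space_restrict_space)
qed

text \<open>The coordinates of the inverse isomorphism are Borel functions on \<open>Z\<close> that
  jointly separate its points, as \<open>field_power_in\<close> requires.\<close>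

lemma (in fubini_ideal) borel_isomorphic_image_field_power_in:
  assumes C: "algebraically_independent_over_Rats C" "compact C" and XC: "X \<subseteq> C"
    and X: "\<And>Z s. s \<in> borel_measurable (restrict_space borel Z) \<Longrightarrow> s ` Z \<subseteq> X \<Longrightarrow>
      (\<And>x. {z \<in> Z. s z = x} \<in> I) \<Longrightarrow> Z \<in> I"
    and Z: "borel_isomorphic_image (finite_power (rat_field_generated X) n) Z"
  shows "Z \<in> I"
proof -
  let ?T = "finite_power (rat_field_generated X) n"
  obtain \<phi> where \<phi>: "bij_betw \<phi> (topspace ?T) Z"
    "inv_into (topspace ?T) \<phi> \<in> measurable (borel_measure_of (top_of_set Z)) (borel_measure_of ?T)"
    using Z unfolding borel_isomorphic_image_def by blast
  let ?\<psi> = "inv_into (topspace ?T) \<phi>"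
  have bij: "bij_betw ?\<psi> Z (topspace ?T)" using \<phi>(1) by (rule bij_betw_inv_into)
  have mem: "?\<psi> z \<in> {..<n} \<rightarrow>\<^sub>E rat_field_generated X" if "z \<in> Z" for z
    using bij_betwE[OF bij] that by (simp add: finite_power_def)
  show ?thesis
  proof (rule field_power_in[OF C XC X])
    show "(\<lambda>z. ?\<psi> z j) \<in> borel_measurable (restrict_space borel Z)" if "j < n" for j
      using measurable_borel_measure_of_subspace[OF \<phi>(2)] measurable_finite_power_component[OF that]
      by (rule measurable_compose)
    show "?\<psi> z j \<in> rat_field_generated X" if "j < n" "z \<in> Z" for j z
      using mem[OF that(2)] that(1) by (auto simp: PiE_iff)
    show "z = w" if zw: "z \<in> Z" "w \<in> Z" and eq: "\<And>j. j < n \<Longrightarrow> ?\<psi> z j = ?\<psi> w j" for z w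
    proof -
      have "?\<psi> z = ?\<psi> w" by (rule PiE_ext[OF mem[OF zw(1)] mem[OF zw(2)]]) (simp add: eq)
      then show ?thesis using inj_onD[OF bij_betw_imp_inj_on[OF bij]] zw by blast
    qed
  qed
qed

text \<open>For a pair of expressions and a bound \<open>1 / (k + 1)\<close> below the absolute
  value of the denominator, the admissible tuples form a closed subset of a power of
  \<open>X\<close> on which the quotient is continuous. Countably many such images cover the field,
  and the factor \<open>W\<close> is carried along unchanged.\<close>

lemma hurewicz_covering_field_times:
  fixes W :: "'b topology" and X :: "real set"
  assumes X: "\<And>Z :: ((nat \<Rightarrow> real) \<times> 'b) topology.
      hurewicz_covering Z \<Longrightarrow> hurewicz_covering (prod_topology (top_of_set X) Z)"
    and W: "hurewicz_covering W"
  shows "hurewicz_covering (prod_topology (top_of_set (rat_field_generated X)) W)"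
proof -
  define E where "E N q k = {x \<in> topspace (finite_power X N). 1 / real (Suc k) \<le> \<bar>peval q x\<bar>}" for N q k
  define A where "A = (\<lambda>(N, p, q, k). (\<lambda>x. peval p x / peval q x) ` E N q k \<times> topspace W)"
  define P where "P = {(N :: nat, p, q, k :: nat). set_pexp p \<union> set_pexp q \<subseteq> {..<N}}"
  have cont: "continuous_map (finite_power X N) euclidean (peval p)" if "set_pexp p \<subseteq> {..<N}" for N p
  proof (rule continuous_map_peval)
    fix v assume "v \<in> set_pexp p"
    then have "continuous_map (finite_power X N) (top_of_set X) (\<lambda>x. x v)"
      using that unfolding finite_power_def by (intro continuous_map_product_projection) blast
    then show "continuous_map (finite_power X N) euclidean (\<lambda>x. x v)"
      by (simp add: continuous_map_in_subtopology)
  qed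
  have nz: "peval q x \<noteq> 0" if "x \<in> E N q k" for N q k x
  proof -
    have "0 < 1 / real (Suc k)" by simp
    then show ?thesis using that unfolding E_def by auto
  qed
  have piece: "hurewicz_covering (subtopology (prod_topology (top_of_set (rat_field_generated X)) W) (A (N, p, q, k)))"
    if pq: "set_pexp p \<union> set_pexp q \<subseteq> {..<N}" for N p q k
  proof -
    let ?E = "E N q k \<times> topspace W"
    let ?f = "\<lambda>x. peval p x / peval q x"
    have E: "E N q k \<subseteq> topspace (finite_power X N)" by (auto simp: E_def)
    have "closedin (finite_power X N) {x \<in> topspace (finite_power X N). \<bar>peval q x\<bar> \<in> {1 / real (Suc k)..}}"
      using cont[of q N] pq by (intro closedin_continuous_map_preimage[of _ euclidean] continuous_map_real_abs) auto
    then have "closedin (finite_power X N) (E N q k)" by (simp add: E_def)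
    then have "closedin (prod_topology (finite_power X N) W) ?E"
      by (simp add: closedin_prod_Times_iff)
    then have "hurewicz_covering (subtopology (prod_topology (finite_power X N) W) ?E)"
      by (intro hurewicz_covering_closed_subset hurewicz_covering_prod_power X W)
    then have hE: "hurewicz_covering (prod_topology (subtopology (finite_power X N) (E N q k)) W)"
      by (simp add: subtopology_Times)
    have f: "continuous_map (subtopology (finite_power X N) (E N q k)) (top_of_set (?f ` E N q k)) ?f"
    proof (rule continuous_map_into_subtopology)
      show "continuous_map (subtopology (finite_power X N) (E N q k)) euclidean ?f"
        using cont pq nz
        by (intro continuous_map_real_divide continuous_map_from_subtopology) auto
    qed auto
    have sub: "?f ` E N q k \<subseteq> rat_field_generated X"
    proof clarify
      fix x assume x: "x \<in> E N q k"
      show "?f x \<in> rat_field_generated X"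
      proof (rule quotient_in_rat_field_generated)
        fix v assume "v \<in> set_pexp p \<union> set_pexp q"
        then have "x v \<in> X" using x E pq by (auto simp: finite_power_def PiE_iff)
        then show "x v \<in> rat_field_generated X" by (rule rat_field_generated_incl)
      qed
    qed
    have "subtopology (prod_topology (top_of_set (rat_field_generated X)) W) (A (N, p, q, k)) =
        prod_topology (top_of_set (?f ` E N q k)) W"
      using sub by (simp add: A_def subtopology_Times subtopology_subtopology Int_absorb1)
    moreover have "hurewicz_covering (prod_topology (top_of_set (?f ` E N q k)) W)"
    proof (rule hurewicz_covering_continuous_image[OF hE])
      show "continuous_map (prod_topology (subtopology (finite_power X N) (E N q k)) W)
          (prod_topology (top_of_set (?f ` E N q k)) W) (\<lambda>p. (?f (fst p), snd p))"
        using f by (rule continuous_map_prod_left)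
      show "topspace (prod_topology (top_of_set (?f ` E N q k)) W) \<subseteq>
          (\<lambda>p. (?f (fst p), snd p)) ` topspace (prod_topology (subtopology (finite_power X N) (E N q k)) W)"
        using E by force
    qed
    ultimately show ?thesis by simp
  qed
  show ?thesis
  proof (rule hurewicz_covering_countable_Union)
    show "countable (A ` P)" by simp
    fix B assume "B \<in> A ` P"
    then obtain N p q k where "B = A (N, p, q, k)" "set_pexp p \<union> set_pexp q \<subseteq> {..<N}" by (auto simp: P_def)
    then show "hurewicz_covering (subtopology (prod_topology (top_of_set (rat_field_generated X)) W) B)"
      using piece by simp
  next
    show "topspace (prod_topology (top_of_set (rat_field_generated X)) W) \<subseteq> \<Union>(A ` P)"
    proof
      fix yw assume "yw \<in> topspace (prod_topology (top_of_set (rat_field_generated X)) W)"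
      then obtain y w where yw: "yw = (y, w)" "y \<in> rat_field_generated X" "w \<in> topspace W" by auto
      obtain p0 q0 where pq0: "set_pexp p0 \<subseteq> X" "set_pexp q0 \<subseteq> X"
        "y = peval p0 (\<lambda>x. x) / peval q0 (\<lambda>x. x)"
        using rat_field_generated_quotient[OF yw(2)] by blast
      let ?D = "set_pexp p0 \<union> set_pexp q0"
      obtain N and x :: "nat \<Rightarrow> real" where x: "?D = x ` {..<N}"
        using finite_imp_nat_seg_image_inj_on[of ?D] finite_set_pexp unfolding lessThan_def by blast
      have "y \<in> rat_field_generated (x ` {..<N})"
        unfolding x[symmetric] pq0(3) by (intro quotient_in_rat_field_generated_vars) auto
      then obtain p q where pq: "set_pexp p \<subseteq> {..<N}" "set_pexp q \<subseteq> {..<N}" "peval q x \<noteq> 0"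
        "y = peval p x / peval q x"
        by (rule rat_field_generated_image)
      \<comment> \<open>Points of a finite power are \<open>undefined\<close> outside their index
        set, so the sequence has to be restricted; the expressions only read indices below
        \<open>N\<close>.\<close>
      let ?x = "restrict x {..<N}"
      have eq: "peval p ?x = peval p x" "peval q ?x = peval q x"
        using pq(1,2) by (auto intro!: peval_cong)
      obtain k where "inverse (real (Suc k)) < \<bar>peval q x\<bar>"
        using reals_Archimedean[of "\<bar>peval q x\<bar>"] pq(3) by auto
      moreover have "?x \<in> topspace (finite_power X N)"
      proof -
        have "x ` {..<N} \<subseteq> X" using x pq0(1,2) by blast
        then show ?thesis by (auto simp: finite_power_def)
      qed
      ultimately have "?x \<in> E N q k" by (simp add: E_def eq inverse_eq_divide)
      then have "peval p ?x / peval q ?x \<in> (\<lambda>x. peval p x / peval q x) ` E N q k" by (rule imageI)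
      then have "yw \<in> A (N, p, q, k)" using yw(1,3) pq(4) eq by (simp add: A_def)
      moreover have "(N, p, q, k) \<in> P" using pq(1,2) by (simp add: P_def)
      ultimately show "yw \<in> \<Union>(A ` P)" by blast
    qed
  qed
qed

theorem theorem7p1:
  fixes C X :: "real set"
    and h :: "(nat \<Rightarrow> enat) \<Rightarrow> real" and h' :: "real \<Rightarrow> (nat \<Rightarrow> enat)"
    and S :: "(nat \<Rightarrow> nat) set"
  assumes "C homeomorphic (UNIV :: (nat \<Rightarrow> bool) set)"
    and "algebraically_independent_over_Rats C"
    and "homeomorphism increasing_enat C h h'"
    and "b_scale S"
    and "X = h ` ((\<lambda>f. enat \<circ> f) ` S \<union> increasing_enat_inf)"
  shows "\<forall>n. hurewicz_space (finite_power (rat_field_generated X) n) \<and>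
             universally_null (finite_power (rat_field_generated X) n) \<and>
             universally_meager (finite_power (rat_field_generated X) n)"
proof
  fix n
  let ?T = "finite_power (rat_field_generated X) n"
  have "compact (UNIV :: (nat \<Rightarrow> bool) set)"
  proof -
    have "compactin (product_topology (\<lambda>_. euclidean) (UNIV :: nat set)) (\<Pi>\<^sub>E _\<in>UNIV. (UNIV :: bool set))"
      by (subst compactin_PiE) (simp add: finite_imp_compact)
    then show ?thesis by (simp add: euclidean_product_topology PiE_UNIV_domain flip: compactin_euclidean_iff)
  qed
  then have C: "compact C" using assms(1) homeomorphic_compactness by blast
  have "(\<lambda>f. enat \<circ> f) ` S \<union> increasing_enat_inf \<subseteq> increasing_enat"
    using assms(4) strict_mono_in_increasing_enat by (auto simp: b_scale_def increasing_enat_inf_def)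
  then have XC: "X \<subseteq> C" using assms(3,5) unfolding homeomorphism_def by blast
  have small: "Z \<in> I" if I: "fubini_ideal I" and Z: "borel_isomorphic_image ?T Z" for I Z
  proof -
    interpret fubini_ideal I by (rule I)
    show ?thesis
      by (rule borel_isomorphic_image_field_power_in[OF assms(2) C XC _ Z])
         (rule scale_set_in[OF assms(4,3) C], auto simp: assms(5))
  qed
  have "hurewicz_covering ?T"
    by (intro hurewicz_covering_power hurewicz_covering_field_times)
       (auto simp: assms(5) intro: hurewicz_covering_scale_set_times[OF assms(4,3)])
  then have "hurewicz_space ?T" by (rule hurewicz_covering_imp_hurewicz_space)
  moreover have "universally_null ?T"
    unfolding universally_null_def
    using metrizable_space_finite_power separable_space_finite_power small[OF fubini_ideal_null] by blast
  moreover have "universally_meager ?T"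
    unfolding universally_meager_def
    using metrizable_space_finite_power separable_space_finite_power small[OF fubini_ideal_meager] by blast
  ultimately show "hurewicz_space ?T \<and> universally_null ?T \<and> universally_meager ?T" by blast
qed

end
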